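(* Let $q_1,\ldots,q_k$ be positive rational numbers. Then there exists a simple planar graph $G=(V,E)$ and an edge $e\in E$ such that \[ \frac{\tau(G-e)}{\tau(G/e)}\ =\ q_1+\ldots+q_k \] and \[ |E|\ =\ 4\big(\mathrm{S}(q_1)+\ldots+\mathrm{S}(q_k)\big)+1. \]
   Context: For a graph $G$ without loops, $\tau(G)$ denotes the number of spanning trees. For an edge $e$, $G-e$ is the graph obtained by deleting $e$, and $G/e$ is the graph obtained by contracting $e$ and removing all resulting loops (multiple edges kept). A simple graph has no loops and no multiple edges. For integers $a_0\ge 0$ and $a_1,\ldots,a_\ell\ge 1$, the continued fraction $[a_0;a_1,\ldots,a_\ell]$ is $a_0+\cfrac{1}{a_1+\cfrac{1}{\ddots+\frac{1}{a_\ell}}}$. Every positive rational $q$ has such a representation, and for $q=[a_0;a_1,\ldots,a_\ell]$ one defines $\mathrm{S}(q):=a_0+a_1+\ldots+a_\ell$; this is independent of the choice among the two representations (since $[a_0;a_1,\ldots,a_\ell,1]=[a_0;a_1,\ldots,a_\ell+1]$). *)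

theory Defs
  imports "HOL-Analysis.Analysis"
begin

section \<open>Continued fractions\<close>

fun cfrac :: "nat list \<Rightarrow> rat" where
  "cfrac [] = 0"
| "cfrac [a] = of_nat a"
| "cfrac (a # b # bs) = of_nat a + 1 / cfrac (b # bs)"

text \<open>
  The list \<open>[a\<^sub>0, a\<^sub>1, \<dots>, a\<^sub>l]\<close> is an admissible sequence of partial quotients if
  \<open>a\<^sub>0 \<ge> 0\<close> and \<open>a\<^sub>1, \<dots>, a\<^sub>l \<ge> 1\<close>.
\<close>

definition admissible :: "nat list \<Rightarrow> bool" where
  "admissible as \<longleftrightarrow> as \<noteq> [] \<and> (\<forall>a \<in> set (tl as). a \<ge> 1)"

text \<open>The description is unique for nonnegative \<open>q\<close>; see \<open>quot_sum_eq\<close> and \<open>ex_cfrac\<close> below.\<close>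

definition quot_sum :: "rat \<Rightarrow> nat" where
  "quot_sum q = (THE s. \<exists>as. admissible as \<and> cfrac as = q \<and> s = sum_list as)"

lemma cfrac_Cons: "as \<noteq> [] \<Longrightarrow> cfrac (a # as) = of_nat a + 1 / cfrac as"
  by (cases as) auto

lemma cfrac_ge_1:
  assumes "as \<noteq> []" "\<forall>a \<in> set as. a \<ge> 1"
  shows "cfrac as \<ge> 1" and "cfrac as = 1 \<Longrightarrow> as = [1]"
proof -
  have "cfrac as \<ge> 1 \<and> (cfrac as = 1 \<longrightarrow> as = [1])"
    using assms
  proof (induction as)
    case (Cons a as)
    have a: "(of_nat a :: rat) \<ge> 1"
      using Cons.prems by simp
    show ?case
    proof (cases "as = []")
      case False
      with Cons have "cfrac as \<ge> 1" by auto
      hence "1 / cfrac as > 0" by simp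
      with a have "of_nat a + 1 / cfrac as > 1" by linarith
      with False show ?thesis by (simp add: cfrac_Cons)
    qed (use a in auto)
  qed auto
  thus "cfrac as \<ge> 1" and "cfrac as = 1 \<Longrightarrow> as = [1]" by auto
qed

lemma sum_list_cfrac_unique_aux:
  assumes "\<forall>b \<in> set bs. b \<ge> 1" "bs \<noteq> []" "of_nat a = of_nat b + 1 / cfrac bs"
  shows "a = b + sum_list bs"
proof -
  define c where "c = cfrac bs"
  have c: "c \<ge> 1" using cfrac_ge_1(1)[OF assms(2,1)] by (simp add: c_def)
  have eq: "(of_nat a :: rat) = of_nat b + 1 / c" using assms(3) by (simp add: c_def)
  have "1 / c > 0" "1 / c \<le> 1" using c by (auto simp: field_simps)
  with eq have "(of_nat b :: rat) < of_nat a" "(of_nat a :: rat) \<le> of_nat (b + 1)"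
    by simp_all
  hence "b < a" "a \<le> b + 1"
    by (simp_all only: of_nat_less_iff of_nat_le_iff)
  hence "a = b + 1" by simp
  with eq have "c = 1" using c by (simp add: field_simps)
  hence "bs = [1]" using cfrac_ge_1(2)[OF assms(2,1)] by (simp add: c_def)
  thus ?thesis using \<open>a = b + 1\<close> by simp
qed

lemma sum_list_cfrac_unique:
  assumes "admissible as" "admissible bs" "cfrac as = cfrac bs"
  shows "sum_list as = sum_list bs"
  using assms
proof (induction as arbitrary: bs)
  case Nil
  thus ?case by (simp add: admissible_def)
next
  case (Cons a as)
  obtain b bs' where bs: "bs = b # bs'"
    using Cons.prems(2) by (cases bs) (auto simp: admissible_def)
  have ge: "\<forall>x \<in> set as. x \<ge> 1" "\<forall>x \<in> set bs'. x \<ge> 1"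
    using Cons.prems bs by (auto simp: admissible_def)
  consider "as = []" "bs' = []" | "as = []" "bs' \<noteq> []" | "as \<noteq> []" "bs' = []"
    | "as \<noteq> []" "bs' \<noteq> []" by blast
  thus ?case
  proof cases
    case 1
    thus ?thesis using Cons.prems bs by simp
  next
    case 2
    thus ?thesis
      using sum_list_cfrac_unique_aux[OF ge(2), of a b] Cons.prems bs by (simp add: cfrac_Cons)
  next
    case 3
    thus ?thesis
      using sum_list_cfrac_unique_aux[OF ge(1), of b a] Cons.prems bs by (simp add: cfrac_Cons)
  next
    case 4
    define c d where "c = cfrac as" and "d = cfrac bs'"
    have cd: "c \<ge> 1" "d \<ge> 1"
      using cfrac_ge_1(1)[OF 4(1) ge(1)] cfrac_ge_1(1)[OF 4(2) ge(2)] by (simp_all add: c_def d_def)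
    hence inv: "1 / c > 0" "1 / c \<le> 1" "1 / d > 0" "1 / d \<le> 1"
      by (auto simp: field_simps)
    have eq: "of_nat a + 1 / c = of_nat b + 1 / d"
      using Cons.prems bs 4 by (simp add: cfrac_Cons c_def d_def)
    have "(of_nat a :: rat) < of_nat (b + 1)" "(of_nat b :: rat) < of_nat (a + 1)"
      unfolding of_nat_add of_nat_1 using eq inv by linarith+
    hence "a < b + 1" "b < a + 1"
      by (simp_all only: of_nat_less_iff)
    hence ab: "a = b" by simp
    hence "c = d" using eq by simp
    moreover have "admissible as" "admissible bs'"
      using ge 4 list.set_sel(2) by (metis admissible_def)+
    ultimately have "sum_list as = sum_list bs'"
      using Cons.IH[of bs'] unfolding c_def d_def by blast
    thus ?thesis using ab bs by simp
  qed
qed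

lemma ex_cfrac_aux:
  "n > 0 \<Longrightarrow> \<exists>as. admissible as \<and> cfrac as = of_nat m / of_nat n"
proof (induction n arbitrary: m rule: less_induct)
  case (less n)
  define a r where "a = m div n" and "r = m mod n"
  have m: "(of_nat m :: rat) = of_nat a * of_nat n + of_nat r"
    unfolding a_def r_def by (metis div_mult_mod_eq of_nat_add of_nat_mult)
  show ?case
  proof (cases "r = 0")
    case True
    hence "cfrac [a] = of_nat m / of_nat n" using m less.prems by simp
    moreover have "admissible [a]" by (simp add: admissible_def)
    ultimately show ?thesis by blast
  next
    case False
    have rn: "r < n" using less.prems by (simp add: r_def)
    then obtain as where as: "admissible as" "cfrac as = of_nat n / of_nat r"
      using less.IH[of r n] False by auto
    obtain b bs where b: "as = b # bs" using as(1) by (cases as) (auto simp: admissible_def)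
    have gt: "cfrac as > 1" using as(2) rn False by simp
    have bs1: "\<forall>x \<in> set bs. x \<ge> 1" using as(1) b by (simp add: admissible_def)
    have "b \<ge> 1"
    proof (rule ccontr)
      assume "\<not> b \<ge> 1"
      hence b0: "b = 0" by simp
      have "bs \<noteq> []" using gt b b0 by auto
      with gt b b0 cfrac_ge_1(1)[OF _ bs1] show False
        by (auto simp: cfrac_Cons)
    qed
    hence "admissible (a # as)" using as(1) b by (auto simp: admissible_def)
    moreover have "cfrac (a # as) = of_nat m / of_nat n"
    proof -
      have "cfrac (a # as) = of_nat a + of_nat r / of_nat n"
        using b as(2) by (simp add: cfrac_Cons del: cfrac.simps)
      thus ?thesis using m less.prems by (simp add: field_simps)
    qed
    ultimately show ?thesis by blast
  qed
qed

lemma ex_cfrac: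
  assumes "q \<ge> 0"
  shows "\<exists>as. admissible as \<and> cfrac as = q"
proof -
  obtain a b where ab: "quotient_of q = (a, b)" by (cases "quotient_of q")
  have b: "b > 0" and q: "q = of_int a / of_int b"
    using quotient_of_denom_pos[OF ab] quotient_of_div[OF ab] by auto
  have "a \<ge> 0" using assms b q by (simp add: zero_le_divide_iff)
  hence "q = of_nat (nat a) / of_nat (nat b)" using b q by simp
  thus ?thesis using ex_cfrac_aux[of "nat b" "nat a"] b by simp
qed

lemma quot_sum_eq:
  assumes "admissible as"
  shows "quot_sum (cfrac as) = sum_list as"
  unfolding quot_sum_def
proof (rule the_equality)
  show "\<exists>bs. admissible bs \<and> cfrac bs = cfrac as \<and> sum_list as = sum_list bs"
    using assms by blast
next
  fix s
  assume "\<exists>bs. admissible bs \<and> cfrac bs = cfrac as \<and> s = sum_list bs"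
  thus "s = sum_list as"
    using sum_list_cfrac_unique assms by blast
qed


section \<open>Loopless multigraphs\<close>

record ('v, 'e) mgraph =
  verts :: "'v set"
  edges :: "'e set"
  ends :: "'e \<Rightarrow> 'v set"

definition loopless_mgraph :: "('v, 'e) mgraph \<Rightarrow> bool" where
  "loopless_mgraph G \<longleftrightarrow>
     finite (verts G) \<and> verts G \<noteq> {} \<and> finite (edges G) \<and>
     (\<forall>e \<in> edges G. ends G e \<subseteq> verts G \<and> card (ends G e) = 2)"

definition simple_mgraph :: "('v, 'e) mgraph \<Rightarrow> bool" where
  "simple_mgraph G \<longleftrightarrow> loopless_mgraph G \<and> inj_on (ends G) (edges G)"

definition delete_edge :: "('v, 'e) mgraph \<Rightarrow> 'e \<Rightarrow> ('v, 'e) mgraph" where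
  "delete_edge G e = G\<lparr>edges := edges G - {e}\<rparr>"

text \<open>
  The vertices of \<open>G/e\<close> are the blocks of the partition of the vertex set of \<open>G\<close> whose only
  non-singleton block is the set of the two ends of \<open>e\<close>. The cardinality condition discards
  the edges that become loops, among them \<open>e\<close> itself.
\<close>

definition merge_block :: "('v, 'e) mgraph \<Rightarrow> 'e \<Rightarrow> 'v \<Rightarrow> 'v set" where
  "merge_block G e v = (if v \<in> ends G e then ends G e else {v})"

definition contract_edge :: "('v, 'e) mgraph \<Rightarrow> 'e \<Rightarrow> ('v set, 'e) mgraph" where
  "contract_edge G e =
     \<lparr>verts = merge_block G e ` verts G,
      edges = {f \<in> edges G. card (merge_block G e ` ends G f) = 2},
      ends = (\<lambda>f. merge_block G e ` ends G f)\<rparr>"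


section \<open>Spanning trees\<close>

definition connected_mgraph :: "('v, 'e) mgraph \<Rightarrow> bool" where
  "connected_mgraph G \<longleftrightarrow>
     verts G \<noteq> {} \<and>
     (\<forall>u \<in> verts G. \<forall>v \<in> verts G. (u, v) \<in> {(x, y). \<exists>e \<in> edges G. ends G e = {x, y}}\<^sup>*)"

text \<open>Length 2 is allowed: two parallel edges form a cycle.\<close>

definition is_cycle :: "('v, 'e) mgraph \<Rightarrow> 'v list \<Rightarrow> 'e list \<Rightarrow> bool" where
  "is_cycle G vs es \<longleftrightarrow>
     length vs = length es \<and> length es \<ge> 2 \<and> distinct vs \<and> distinct es \<and>
     set vs \<subseteq> verts G \<and> set es \<subseteq> edges G \<and>
     (\<forall>i < length es. ends G (es ! i) = {vs ! i, vs ! (Suc i mod length es)})"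

definition is_tree :: "('v, 'e) mgraph \<Rightarrow> bool" where
  "is_tree G \<longleftrightarrow> connected_mgraph G \<and> \<not> (\<exists>vs es. is_cycle G vs es)"

text \<open>A spanning tree is identified with its edge set.\<close>

definition num_spanning_trees :: "('v, 'e) mgraph \<Rightarrow> nat" where
  "num_spanning_trees G = card {T. T \<subseteq> edges G \<and> is_tree (G\<lparr>edges := T\<rparr>)}"


section \<open>Planarity\<close>

text \<open>
  A plane drawing maps vertices to distinct points and edges to arcs joining their ends, such that
  the interior of an edge meets neither a vertex nor another edge.
\<close>

definition plane_drawing ::
    "('v, 'e) mgraph \<Rightarrow> ('v \<Rightarrow> real ^ 2) \<Rightarrow> ('e \<Rightarrow> real \<Rightarrow> real ^ 2) \<Rightarrow> bool" where
  "plane_drawing G p c \<longleftrightarrow>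
     inj_on p (verts G) \<and>
     (\<forall>e \<in> edges G.
        arc (c e) \<and> {pathstart (c e), pathfinish (c e)} = p ` ends G e \<and>
        (path_image (c e) - p ` ends G e) \<inter> p ` verts G = {} \<and>
        (\<forall>f \<in> edges G. f \<noteq> e \<longrightarrow> (path_image (c e) - p ` ends G e) \<inter> path_image (c f) = {}))"

definition planar :: "('v, 'e) mgraph \<Rightarrow> bool" where
  "planar G \<longleftrightarrow> (\<exists>p c. plane_drawing G p c)"

end

(*
  tau(G - e) / tau(G / e) is the effective conductance of G - e between the ends of e, every edge
  being a unit conductor.  Conductances add in parallel and resistances add in series, so the
  continued fraction of q yields a series-parallel network of S(q) unit conductors with
  conductance q, and networks for q_1, ..., q_k in parallel realize the sum.  Replacing each
  conductor by a 4-cycle with opposite terminals (again of conductance 1/2 + 1/2 = 1) makes the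
  graph simple with nonadjacent terminals, so that e can be added.

  Spanning trees of G - e and of G / e are the minimal edge sets T for which T, respectively
  T + e, connects all vertices.  These two upward closed properties are exchanged by the duality
  between series and parallel composition, so both counts follow from the same product formulas.

  For planarity, the network is a subgraph of a graph built from one edge by repeatedly joining a
  new vertex to both ends of an existing edge; in a straight-line drawing the new vertex can be
  placed next to the midpoint of that edge.
*)
theory Submission
  imports Defs
begin

section \<open>Minimal sets\<close>

text \<open>Spanning trees enter the counting as minimal connecting edge sets. For monotone
  \<open>P\<close>, failure after every single deletion is the same as inclusion-minimality.\<close>

definition mins :: "('e set \<Rightarrow> bool) \<Rightarrow> 'e set \<Rightarrow> 'e set set" where
  "mins P E = {T. T \<subseteq> E \<and> P T \<and> (\<forall>e \<in> T. \<not> P (T - {e}))}"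

lemma mins_subset_Pow: "mins P E \<subseteq> Pow E"
  by (auto simp: mins_def)

lemma finite_mins: "finite E \<Longrightarrow> finite (mins P E)"
  by (rule finite_subset[OF mins_subset_Pow]) simp

lemma mins_cong:
  assumes "\<And>T. T \<subseteq> E \<Longrightarrow> P T \<longleftrightarrow> Q T"
  shows "mins P E = mins Q E"
proof -
  have "P (T - {e}) \<longleftrightarrow> Q (T - {e})" if "T \<subseteq> E" for T e
    using that by (intro assms) auto
  with assms show ?thesis unfolding mins_def by blast
qed

text \<open>Passes from the named edges of a multigraph to edges identified with their pairs of
  ends. Injectivity of \<open>h\<close> then expresses the absence of multiple edges.\<close>

lemma card_mins_image:
  assumes "inj_on h I"
  shows "card (mins (\<lambda>T. P (h ` T)) I) = card (mins P (h ` I))"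
proof (rule bij_betw_same_card)
  have eq: "h ` (T - {i}) = h ` T - {h i}" if "T \<subseteq> I" "i \<in> T" for T i
    using inj_on_image_set_diff[OF assms, of T "{i}"] that by auto
  show "bij_betw (image h) (mins (\<lambda>T. P (h ` T)) I) (mins P (h ` I))"
    unfolding bij_betw_def
  proof
    show "inj_on (image h) (mins (\<lambda>T. P (h ` T)) I)"
      by (rule inj_on_subset[OF inj_on_image_Pow[OF assms] mins_subset_Pow])
    show "image h ` mins (\<lambda>T. P (h ` T)) I = mins P (h ` I)"
    proof (intro equalityI subsetI)
      fix S assume "S \<in> image h ` mins (\<lambda>T. P (h ` T)) I"
      then obtain T where "S = h ` T" "T \<subseteq> I" "P (h ` T)" "\<forall>i\<in>T. \<not> P (h ` (T - {i}))"
        by (auto simp: mins_def)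
      thus "S \<in> mins P (h ` I)" by (auto simp: mins_def eq)
    next
      fix S assume S: "S \<in> mins P (h ` I)"
      then obtain T where T: "T \<subseteq> I" "S = h ` T"
        by (auto simp: mins_def subset_image_iff)
      with S have "T \<in> mins (\<lambda>T. P (h ` T)) I" by (auto simp: mins_def eq)
      with T show "S \<in> image h ` mins (\<lambda>T. P (h ` T)) I" by blast
    qed
  qed
qed

section \<open>Minimal sets over a disjoint union of ground sets\<close>

definition joins :: "'e set set \<Rightarrow> 'e set set \<Rightarrow> 'e set set" where
  "joins \<A> \<B> = (\<lambda>(A, B). A \<union> B) ` (\<A> \<times> \<B>)"

text \<open>Both parts of a union are recovered by intersecting it with \<open>E\<close> and with
  \<open>F\<close>.\<close>

lemma card_joins:
  assumes "\<A> \<subseteq> Pow E" "\<B> \<subseteq> Pow F" "E \<inter> F = {}"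
  shows "card (joins \<A> \<B>) = card \<A> * card \<B>"
proof -
  have "inj_on (\<lambda>(A, B). A \<union> B) (\<A> \<times> \<B>)"
  proof (rule inj_onI, clarify)
    fix A B A' B'
    assume "A \<in> \<A>" "B \<in> \<B>" "A' \<in> \<A>" "B' \<in> \<B>" and eq: "A \<union> B = A' \<union> B'"
    hence "A \<subseteq> E" "B \<subseteq> F" "A' \<subseteq> E" "B' \<subseteq> F" using assms by auto
    hence "A = (A \<union> B) \<inter> E" "A' = (A' \<union> B') \<inter> E" "B = (A \<union> B) \<inter> F" "B' = (A' \<union> B') \<inter> F"
      using assms(3) by blast+
    thus "A = A' \<and> B = B'" using eq by metis
  qed
  thus ?thesis by (simp add: joins_def card_image card_cartesian_product)
qed

text \<open>Deleting an element of \<open>E\<close> from \<open>A \<union> B\<close> leaves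
  \<open>B\<close> unchanged, and conversely, so minimality is tested on the two sides
  separately.\<close>

lemma mins_conj:
  assumes "E \<inter> F = {}"
    and "\<And>A B. A \<subseteq> E \<Longrightarrow> B \<subseteq> F \<Longrightarrow> R (A \<union> B) \<longleftrightarrow> P A \<and> Q B"
  shows "mins R (E \<union> F) = joins (mins P E) (mins Q F)"
proof (intro equalityI subsetI)
  have sep: "(A \<union> B) - {e} = (A - {e}) \<union> (B - {e})" for A B :: "'a set" and e by blast
  have drop: "B - {e} = B" if "e \<in> A" "A \<subseteq> E" "B \<subseteq> F" for A B e using assms(1) that by blast
  have drop': "A - {e} = A" if "e \<in> B" "A \<subseteq> E" "B \<subseteq> F" for A B e using assms(1) that by blast
  have R: "R (A \<union> B - {e}) \<longleftrightarrow> P (A - {e}) \<and> Q (B - {e})" if "A \<subseteq> E" "B \<subseteq> F" for A B e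
    unfolding sep by (rule assms(2)) (use that in auto)
  { fix T assume T: "T \<in> mins R (E \<union> F)"
    define A B where "A = T \<inter> E" and "B = T \<inter> F"
    have AB: "T = A \<union> B" "A \<subseteq> E" "B \<subseteq> F" using T by (auto simp: mins_def A_def B_def)
    have "P A" "Q B" using T assms(2)[OF AB(2,3)] AB(1) by (auto simp: mins_def)
    moreover have "\<not> P (A - {e})" if "e \<in> A" for e
      using T AB R[OF AB(2,3), of e] that \<open>Q B\<close> drop[OF that AB(2,3)] by (auto simp: mins_def)
    moreover have "\<not> Q (B - {e})" if "e \<in> B" for e
      using T AB R[OF AB(2,3), of e] that \<open>P A\<close> drop'[OF that AB(2,3)] by (auto simp: mins_def)
    ultimately show "T \<in> joins (mins P E) (mins Q F)"
      using AB unfolding joins_def mins_def by blast }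
  { fix T assume "T \<in> joins (mins P E) (mins Q F)"
    then obtain A B where T: "T = A \<union> B" and A: "A \<in> mins P E" and B: "B \<in> mins Q F"
      by (auto simp: joins_def)
    hence AB: "A \<subseteq> E" "B \<subseteq> F" "P A" "Q B" by (auto simp: mins_def)
    have "\<not> R (A \<union> B - {e})" if "e \<in> A \<union> B" for e
      using that A B R[OF AB(1,2)] by (auto simp: mins_def)
    thus "T \<in> mins R (E \<union> F)" using T AB assms(2)[OF AB(1,2)] by (auto simp: mins_def) }
qed

lemma card_mins_conj:
  assumes "E \<inter> F = {}"
    and "\<And>A B. A \<subseteq> E \<Longrightarrow> B \<subseteq> F \<Longrightarrow> R (A \<union> B) \<longleftrightarrow> P A \<and> Q B"
  shows "card (mins R (E \<union> F)) = card (mins P E) * card (mins Q F)"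
proof -
  have "mins R (E \<union> F) = joins (mins P E) (mins Q F)"
    by (rule mins_conj) (use assms in auto)
  thus ?thesis using card_joins[OF mins_subset_Pow mins_subset_Pow assms(1)] by simp
qed

text \<open>The exchange hypotheses say that no set is minimal for both \<open>P\<close> and \<open>Q\<close>.\<close>

lemma mins_disj:
  assumes "E \<inter> F = {}"
    and R: "\<And>A B. A \<subseteq> E \<Longrightarrow> B \<subseteq> F \<Longrightarrow> R (A \<union> B) \<longleftrightarrow> P A \<and> Q' B \<or> Q A \<and> P' B"
    and mono: "mono P" "mono P'"
    and exch: "\<And>A. A \<subseteq> E \<Longrightarrow> P A \<Longrightarrow> \<exists>e\<in>A. Q (A - {e})"
      "\<And>B. B \<subseteq> F \<Longrightarrow> P' B \<Longrightarrow> \<exists>e\<in>B. Q' (B - {e})"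
  shows "mins R (E \<union> F) = joins (mins P E) (mins Q' F) \<union> joins (mins Q E) (mins P' F)"
proof (intro equalityI subsetI)
  have drop: "(A \<union> B) - {e} = (A - {e}) \<union> B" if "e \<in> A" "A \<subseteq> E" "B \<subseteq> F" for A B e
    using assms(1) that by blast
  have drop': "(A \<union> B) - {e} = A \<union> (B - {e})" if "e \<in> B" "A \<subseteq> E" "B \<subseteq> F" for A B e
    using assms(1) that by blast
  have RA: "R (A \<union> B - {e}) \<longleftrightarrow> P (A - {e}) \<and> Q' B \<or> Q (A - {e}) \<and> P' B"
    if "e \<in> A" "A \<subseteq> E" "B \<subseteq> F" for A B e
    unfolding drop[OF that] by (rule R) (use that in auto)
  have RB: "R (A \<union> B - {e}) \<longleftrightarrow> P A \<and> Q' (B - {e}) \<or> Q A \<and> P' (B - {e})"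
    if "e \<in> B" "A \<subseteq> E" "B \<subseteq> F" for A B e
    unfolding drop'[OF that] by (rule R) (use that in auto)
  { fix T assume T: "T \<in> mins R (E \<union> F)"
    define A B where "A = T \<inter> E" and "B = T \<inter> F"
    have AB: "T = A \<union> B" "A \<subseteq> E" "B \<subseteq> F" using T by (auto simp: mins_def A_def B_def)
    have "P A \<and> Q' B \<or> Q A \<and> P' B" using T R[OF AB(2,3)] AB(1) by (auto simp: mins_def)
    moreover have "\<not> (P (A - {e}) \<and> Q' B \<or> Q (A - {e}) \<and> P' B)" if "e \<in> A" for e
      using T AB RA[OF that AB(2,3)] that by (auto simp: mins_def)
    moreover have "\<not> (P A \<and> Q' (B - {e}) \<or> Q A \<and> P' (B - {e}))" if "e \<in> B" for e
      using T AB RB[OF that AB(2,3)] that by (auto simp: mins_def)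
    ultimately have "A \<in> mins P E \<and> B \<in> mins Q' F \<or> A \<in> mins Q E \<and> B \<in> mins P' F"
      using AB(2,3) unfolding mins_def by blast
    thus "T \<in> joins (mins P E) (mins Q' F) \<union> joins (mins Q E) (mins P' F)"
      using AB(1) by (auto simp: joins_def) }
  { fix T assume "T \<in> joins (mins P E) (mins Q' F) \<union> joins (mins Q E) (mins P' F)"
    then obtain A B where T: "T = A \<union> B"
      and or: "A \<in> mins P E \<and> B \<in> mins Q' F \<or> A \<in> mins Q E \<and> B \<in> mins P' F"
      by (auto simp: joins_def)
    hence AB: "A \<subseteq> E" "B \<subseteq> F" by (auto simp: mins_def)
    have "R T" using or R[OF AB] T by (auto simp: mins_def)
    moreover have "\<not> R (A \<union> B - {e})" if e: "e \<in> A \<union> B" for e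
    proof
      assume Re: "R (A \<union> B - {e})"
      show False using or
      proof
        assume 1: "A \<in> mins P E \<and> B \<in> mins Q' F"
        \<comment> \<open>If \<open>P' B\<close> held, the exchange would delete an element of
          \<open>B\<close> and keep \<open>Q'\<close>, against minimality of \<open>B\<close>. So
          after a deletion \<open>R\<close> can hold only through \<open>P\<close> and
          \<open>Q'\<close>, and minimality of \<open>A\<close> and \<open>B\<close> excludes that
          too.\<close>
        hence n: "\<not> P' B" using exch(2)[OF AB(2)] by (auto simp: mins_def)
        hence "\<not> P' (B - {e})" using monoD[OF mono(2), of "B - {e}" B] by auto
        thus False using n e Re RA[OF _ AB] RB[OF _ AB] 1 by (auto simp: mins_def)
      next
        assume 1: "A \<in> mins Q E \<and> B \<in> mins P' F"
        hence n: "\<not> P A" using exch(1)[OF AB(1)] by (auto simp: mins_def)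
        hence "\<not> P (A - {e})" using monoD[OF mono(1), of "A - {e}" A] by auto
        thus False using n e Re RA[OF _ AB] RB[OF _ AB] 1 by (auto simp: mins_def)
      qed
    qed
    ultimately show "T \<in> mins R (E \<union> F)" using T AB by (auto simp: mins_def) }
qed

text \<open>The two families of \<open>mins_disj\<close> are disjoint: a common member would meet
  \<open>E\<close> in a set minimal for both \<open>P\<close> and \<open>Q\<close>, which the
  exchange forbids. Hence the cardinalities simply add.\<close>

lemma card_mins_disj:
  assumes "E \<inter> F = {}" "finite E" "finite F"
    and R: "\<And>A B. A \<subseteq> E \<Longrightarrow> B \<subseteq> F \<Longrightarrow> R (A \<union> B) \<longleftrightarrow> P A \<and> Q' B \<or> Q A \<and> P' B"
    and mono: "mono P" "mono P'"
    and exch: "\<And>A. A \<subseteq> E \<Longrightarrow> P A \<Longrightarrow> \<exists>e\<in>A. Q (A - {e})"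
      "\<And>B. B \<subseteq> F \<Longrightarrow> P' B \<Longrightarrow> \<exists>e\<in>B. Q' (B - {e})"
  shows "card (mins R (E \<union> F)) =
    card (mins P E) * card (mins Q' F) + card (mins Q E) * card (mins P' F)"
proof -
  have "joins (mins P E) (mins Q' F) \<inter> joins (mins Q E) (mins P' F) = {}"
  proof (rule ccontr)
    assume "joins (mins P E) (mins Q' F) \<inter> joins (mins Q E) (mins P' F) \<noteq> {}"
    then obtain A B A' B' where *: "A \<in> mins P E" "B \<in> mins Q' F" "A' \<in> mins Q E" "B' \<in> mins P' F"
      "A \<union> B = A' \<union> B'" by (auto simp: joins_def)
    hence "A \<subseteq> E" "A' \<subseteq> E" "B \<subseteq> F" "B' \<subseteq> F" by (auto simp: mins_def)
    hence "A = A'" using *(5) assms(1) by blast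
    thus False using * exch(1)[of A] by (auto simp: mins_def)
  qed
  moreover have eq: "mins R (E \<union> F) = joins (mins P E) (mins Q' F) \<union> joins (mins Q E) (mins P' F)"
    by (rule mins_disj[where P = P and P' = P']) (use assms in auto)
  moreover have "finite (joins (mins P E) (mins Q' F))" "finite (joins (mins Q E) (mins P' F))"
    using assms(2,3) by (auto simp: joins_def finite_mins)
  ultimately show ?thesis
    using eq card_joins[OF mins_subset_Pow mins_subset_Pow assms(1)]
    by (simp add: card_Un_disjoint)
qed

section \<open>Spanning edge sets of networks\<close>

definition linked :: "'v set set \<Rightarrow> ('v \<times> 'v) set" where
  "linked T = {(x, y). {x, y} \<in> T}\<^sup>*"

text \<open>The connecting paths may leave \<open>V\<close>, so one edge set can be tested against
  the vertices of a part as well as against all vertices.\<close>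

definition spans :: "'v set \<Rightarrow> 'v set set \<Rightarrow> bool" where
  "spans V T \<longleftrightarrow> (\<forall>u\<in>V. \<forall>v\<in>V. (u, v) \<in> linked T)"

lemma linked_refl [simp]: "(x, x) \<in> linked T"
  by (simp add: linked_def)

lemma linked_edge: "{x, y} \<in> T \<Longrightarrow> (x, y) \<in> linked T"
  by (auto simp: linked_def)

lemma linked_trans: "(x, y) \<in> linked T \<Longrightarrow> (y, z) \<in> linked T \<Longrightarrow> (x, z) \<in> linked T"
  by (auto simp: linked_def)

lemma linked_sym: "(x, y) \<in> linked T \<Longrightarrow> (y, x) \<in> linked T"
  unfolding linked_def by (rule symD[OF sym_rtrancl]) (auto simp: sym_def insert_commute)

text \<open>An edge may be sent to a path or collapse to a point. This covers the projection of a
  composed network to one of its parts and both directions between a graph and its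
  contraction.\<close>

lemma linked_map:
  assumes "(x, y) \<in> linked T" "\<And>a b. {a, b} \<in> T \<Longrightarrow> (f a, f b) \<in> linked S"
  shows "(f x, f y) \<in> linked S"
  using assms(1) unfolding linked_def[of T]
  by (induction rule: rtrancl_induct) (auto intro: linked_trans assms(2))

lemma linked_subset:
  assumes "\<And>a b. {a, b} \<in> T \<Longrightarrow> (a, b) \<in> linked S"
  shows "linked T \<subseteq> linked S"
  using linked_map[of _ _ T "\<lambda>x. x" S] assms by auto

lemma linked_mono: "T \<subseteq> S \<Longrightarrow> linked T \<subseteq> linked S"
  by (rule linked_subset) (auto intro: linked_edge)

lemma linked_invariant:
  assumes "(x, y) \<in> linked T" "\<And>a b. {a, b} \<in> T \<Longrightarrow> g a \<Longrightarrow> g b" "g x"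
  shows "g y"
  using assms(1) unfolding linked_def by (induction rule: rtrancl_induct) (auto intro: assms)

lemma spansI: 
  assumes "\<And>v. v \<in> V \<Longrightarrow> (r, v) \<in> linked T"
  shows "spans V T"
  unfolding spans_def using assms linked_sym linked_trans by metis

lemma spans_linked: "spans V T \<Longrightarrow> linked T \<subseteq> linked S \<Longrightarrow> spans V S"
  unfolding spans_def by blast

lemma mono_spans: "mono (spans V)"
  by (rule monoI, rule le_boolI, erule spans_linked, erule linked_mono)

lemma linked_insert:
  assumes "(s, t) \<in> linked T"
  shows "linked (insert {s, t} T) = linked T"
proof (rule antisym)
  show "linked (insert {s, t} T) \<subseteq> linked T"
    by (rule linked_subset) (use assms linked_sym in \<open>auto simp: doubleton_eq_iff intro: linked_edge\<close>)
qed (auto intro!: linked_mono)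

text \<open>Take \<open>e\<close> on a path in \<open>T\<close> from \<open>s\<close> to
  \<open>t\<close>. The new edge \<open>{s, t}\<close> together with the rest of the path links the
  two ends of \<open>e\<close>, so it replaces \<open>e\<close>.\<close>

lemma spans_exchange:
  assumes "spans V T" "s \<in> V" "t \<in> V" "s \<noteq> t" "T \<subseteq> {{a, b} |a b. a \<noteq> b}" "finite T"
  shows "\<exists>e\<in>T. spans V (insert {s, t} (T - {e}))"
proof -
  \<comment> \<open>A connecting subset of least size stands in for a path: removing any of its
    edges separates \<open>s\<close> from \<open>t\<close>.\<close>
  define P where "P S \<longleftrightarrow> S \<subseteq> T \<and> (s, t) \<in> linked S" for S
  have "P T" using assms by (auto simp: P_def spans_def)
  then obtain S where S: "P S" "\<And>S'. P S' \<Longrightarrow> card S \<le> card S'"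
    using ex_has_least_nat[of P T card] by blast
  have "S \<noteq> {}" using S(1) assms(4) by (auto simp: P_def linked_def)
  then obtain e where e: "e \<in> S" by blast
  then obtain u v where uv: "e = {u, v}" using S(1) assms(5) by (auto simp: P_def)
  have fin: "finite S" using S(1) assms(6) finite_subset by (auto simp: P_def)
  let ?S = "S - {e}" and ?U = "insert {s, t} (T - {e})"
  have nst: "(s, t) \<notin> linked ?S"
  proof
    assume "(s, t) \<in> linked ?S"
    hence "P ?S" using S(1) by (auto simp: P_def)
    from S(2)[OF this] show False using e fin by (metis card_Diff1_less leD)
  qed
  have sub: "linked ?S \<subseteq> linked ?U" using S(1) by (intro linked_mono) (auto simp: P_def)
  have st: "(s, t) \<in> linked ?U" by (rule linked_edge) simp
  have step: "g b" if "{a, b} \<in> S" "g a" "g u \<longleftrightarrow> g v" "\<And>a b. {a, b} \<in> ?S \<Longrightarrow> g a \<Longrightarrow> g b" for a b g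
    using that uv by (cases "{a, b} = e") (auto simp: doubleton_eq_iff)
  have stS: "(s, t) \<in> linked S" "(t, s) \<in> linked S"
    using S(1) linked_sym by (auto simp: P_def)
  have inv: "(r, y) \<in> linked ?S" if "{x, y} \<in> ?S" "(r, x) \<in> linked ?S" for r x y
    using that linked_edge linked_trans by metis
  \<comment> \<open>If both ends of \<open>e\<close>, or neither, were reached from \<open>s\<close>
    without \<open>e\<close>, the vertices reached from \<open>s\<close> would be closed under all
    of \<open>S\<close>, and \<open>t\<close> would be among them. The same argument applies to
    \<open>t\<close>.\<close>
  have "((s, u) \<in> linked ?S) \<noteq> ((s, v) \<in> linked ?S)"
    using linked_invariant[OF stS(1), of "\<lambda>x. (s, x) \<in> linked ?S"]
      step[of _ _ "\<lambda>x. (s, x) \<in> linked ?S"] inv[of _ _ s] nst by (metis linked_refl)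
  moreover have "((t, u) \<in> linked ?S) \<noteq> ((t, v) \<in> linked ?S)"
    using linked_invariant[OF stS(2), of "\<lambda>x. (t, x) \<in> linked ?S"]
      step[of _ _ "\<lambda>x. (t, x) \<in> linked ?S"] inv[of _ _ t] nst by (metis linked_refl linked_sym)
  moreover have "\<not> ((s, x) \<in> linked ?S \<and> (t, x) \<in> linked ?S)" for x
    using nst linked_sym linked_trans by metis
  ultimately have "(s, u) \<in> linked ?S \<and> (t, v) \<in> linked ?S \<or> (s, v) \<in> linked ?S \<and> (t, u) \<in> linked ?S"
    by blast
  hence "(s, u) \<in> linked ?U \<and> (t, v) \<in> linked ?U \<or> (s, v) \<in> linked ?U \<and> (t, u) \<in> linked ?U"
    using sub by blast
  hence "(u, v) \<in> linked ?U"
    using st linked_sym linked_trans by metis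
  have "linked T \<subseteq> linked ?U"
  proof (rule linked_subset)
    fix a b assume "{a, b} \<in> T"
    thus "(a, b) \<in> linked ?U" using \<open>(u, v) \<in> linked ?U\<close> uv linked_sym
      by (cases "{a, b} = e") (auto simp: doubleton_eq_iff intro: linked_edge)
  qed
  thus ?thesis using spans_linked[OF assms(1)] e S(1) unfolding P_def by blast
qed

text \<open>An edge is its pair of ends, so multiple edges cannot be expressed. This is why the
  counting formulas for composed networks ask for disjoint edge sets.\<close>

definition network :: "'v \<Rightarrow> 'v \<Rightarrow> 'v set \<Rightarrow> 'v set set \<Rightarrow> bool" where
  "network s t V E \<longleftrightarrow> finite V \<and> s \<in> V \<and> t \<in> V \<and> s \<noteq> t \<and> E \<subseteq> {{a, b} |a b. a \<in> V \<and> b \<in> V \<and> a \<noteq> b}"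

abbreviation trees :: "'v set \<Rightarrow> 'v set set \<Rightarrow> 'v set set set" where
  "trees V E \<equiv> mins (spans V) E"

text \<open>Adding the edge \<open>{s, t}\<close> plays the role of identifying the terminals, as in \<open>G/e\<close>.\<close>

abbreviation cuts :: "'v \<Rightarrow> 'v \<Rightarrow> 'v set \<Rightarrow> 'v set set \<Rightarrow> 'v set set set" where
  "cuts s t V E \<equiv> mins (\<lambda>T. spans V (insert {s, t} T)) E"

lemma network_finite: "network s t V E \<Longrightarrow> finite E"
  by (rule finite_subset[of _ "Pow V"]) (auto simp: network_def)

lemma network_edge:
  assumes "network s t V E" "{a, b} \<in> T" "T \<subseteq> E"
  shows "a \<in> V" "b \<in> V" "a \<noteq> b"
  using assms by (fastforce simp: network_def doubleton_eq_iff)+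

lemma network_exchange:
  assumes "network s t V E" "T \<subseteq> E" "spans V T"
  shows "\<exists>e\<in>T. spans V (insert {s, t} (T - {e}))"
proof (rule spans_exchange)
  show "T \<subseteq> {{a, b} |a b. a \<noteq> b}" using assms(1,2) unfolding network_def by blast
  show "finite T" using network_finite[OF assms(1)] assms(2) finite_subset by blast
qed (use assms in \<open>auto simp: network_def\<close>)

lemma spans_insert_mono: "spans V T \<Longrightarrow> spans V (insert e T)"
  using monoD[OF mono_spans, of T "insert e T"] by auto

lemma spans_Un:
  assumes "spans V1 T" "spans V2 T" "r \<in> V1" "r \<in> V2"
  shows "spans (V1 \<union> V2) T"
  by (rule spansI[of _ r]) (use assms in \<open>auto simp: spans_def\<close>)

text \<open>A path between vertices of \<open>V\<close> is carried by \<open>f\<close> to links in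
  \<open>S\<close> between the same vertices, since \<open>f\<close> fixes \<open>V\<close>.\<close>

lemma spans_retract:
  assumes "spans W T" "V \<subseteq> W"
    and "\<And>a b. {a, b} \<in> T \<Longrightarrow> (f a, f b) \<in> linked S" "\<And>a. a \<in> V \<Longrightarrow> f a = a"
  shows "spans V S"
  unfolding spans_def
proof (intro ballI)
  fix u v assume "u \<in> V" "v \<in> V"
  with assms(1,2) have "(u, v) \<in> linked T" by (auto simp: spans_def)
  from linked_map[of _ _ _ f, OF this assms(3)] show "(u, v) \<in> linked S"
    using assms(4) \<open>u \<in> V\<close> \<open>v \<in> V\<close> by auto
qed

section \<open>Spanning sets under parallel composition\<close>

lemma spans_parallel_insert_left:
  assumes N: "network s t V1 E1" "network s t V2 E2" "V1 \<inter> V2 = {s, t}"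
    and T: "T1 \<subseteq> E1" "T2 \<subseteq> E2"
    and sp: "spans (V1 \<union> V2) (insert {s, t} (T1 \<union> T2))"
  shows "spans V1 (insert {s, t} T1)"
proof (rule spans_retract[OF sp])
  \<comment> \<open>The second network collapses onto its terminals. Its edges become pairs within
    \<open>{s, t}\<close>, which the inserted edge links.\<close>
  let ?f = "\<lambda>x. if x \<in> V1 then x else s"
  have st: "s \<in> V1" "t \<in> V1" using N by (auto simp: network_def)
  have l: "(s, t) \<in> linked (insert {s, t} T1)" by (rule linked_edge) simp
  fix a b assume "{a, b} \<in> insert {s, t} (T1 \<union> T2)"
  then consider "{a, b} = {s, t}" | "{a, b} \<in> T1" | "{a, b} \<in> T2" by blast
  thus "(?f a, ?f b) \<in> linked (insert {s, t} T1)"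
  proof cases
    case 1 thus ?thesis using st l linked_sym by (auto simp: doubleton_eq_iff)
  next
    case 2 thus ?thesis using network_edge[OF N(1) 2 T(1)] by (auto intro!: linked_edge)
  next
    case 3
    have "?f a \<in> {s, t}" "?f b \<in> {s, t}" using network_edge[OF N(2) 3 T(2)] N(3) by auto
    thus ?thesis using l linked_sym by auto
  qed
qed auto

lemma spans_parallel_insert:
  assumes N: "network s t V1 E1" "network s t V2 E2" "V1 \<inter> V2 = {s, t}"
    and T: "T1 \<subseteq> E1" "T2 \<subseteq> E2"
  shows "spans (V1 \<union> V2) (insert {s, t} (T1 \<union> T2)) \<longleftrightarrow>
    spans V1 (insert {s, t} T1) \<and> spans V2 (insert {s, t} T2)"
proof
  assume *: "spans (V1 \<union> V2) (insert {s, t} (T1 \<union> T2))"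
  hence "spans (V2 \<union> V1) (insert {s, t} (T2 \<union> T1))" by (simp add: Un_commute)
  thus "spans V1 (insert {s, t} T1) \<and> spans V2 (insert {s, t} T2)"
    using spans_parallel_insert_left[OF N T *] spans_parallel_insert_left[OF N(2,1) _ T(2,1)] N(3)
    by (simp add: Int_commute)
next
  assume *: "spans V1 (insert {s, t} T1) \<and> spans V2 (insert {s, t} T2)"
  show "spans (V1 \<union> V2) (insert {s, t} (T1 \<union> T2))"
  proof (rule spans_Un)
    show "spans V1 (insert {s, t} (T1 \<union> T2))" "spans V2 (insert {s, t} (T1 \<union> T2))"
      using * by (auto elim!: spans_linked intro!: linked_mono)
  qed (use N in \<open>auto simp: network_def\<close>)
qed

text \<open>One side must link \<open>s\<close> to \<open>t\<close> by itself, and on that side the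
  inserted edge is redundant. The other side only has to span once the terminals are joined.\<close>

lemma spans_parallel:
  assumes N: "network s t V1 E1" "network s t V2 E2" "V1 \<inter> V2 = {s, t}"
    and T: "T1 \<subseteq> E1" "T2 \<subseteq> E2"
  shows "spans (V1 \<union> V2) (T1 \<union> T2) \<longleftrightarrow>
    spans V1 T1 \<and> spans V2 (insert {s, t} T2) \<or> spans V1 (insert {s, t} T1) \<and> spans V2 T2"
    (is "?L \<longleftrightarrow> ?R")
proof
  assume L: ?L
  have F: "spans V1 (insert {s, t} T1)" "spans V2 (insert {s, t} T2)"
    using spans_parallel_insert[OF N T] spans_insert_mono[OF L] by blast+
  have "(s, t) \<in> linked T1 \<or> (s, t) \<in> linked T2"
  proof (rule ccontr)
    assume n: "\<not> ?thesis"
    \<comment> \<open>The vertices reached from \<open>s\<close> inside their own part. The two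
      disjuncts agree on the shared vertices \<open>s\<close> and \<open>t\<close>, because neither
      part links them; so the set is closed under all edges and misses \<open>t\<close>.\<close>
    define g where "g x \<longleftrightarrow> x \<in> V1 \<and> (s, x) \<in> linked T1 \<or> x \<in> V2 \<and> (s, x) \<in> linked T2" for x
    have g: "g x \<longleftrightarrow> (s, x) \<in> linked T1" if "x \<in> V1" for x
    proof (cases "x \<in> V2")
      case True
      with that N(3) have "x = s \<or> x = t" by blast
      with that n True show ?thesis by (auto simp: g_def)
    qed (use that in \<open>simp add: g_def\<close>)
    have g': "g x \<longleftrightarrow> (s, x) \<in> linked T2" if "x \<in> V2" for x
    proof (cases "x \<in> V1")
      case True
      with that N(3) have "x = s \<or> x = t" by blast
      with that n True show ?thesis by (auto simp: g_def)
    qed (use that in \<open>simp add: g_def\<close>)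
    have st: "s \<in> V1" "t \<in> V1" using N by (auto simp: network_def)
    with L have "(s, t) \<in> linked (T1 \<union> T2)" by (auto simp: spans_def)
    hence "g t"
    proof (rule linked_invariant)
      fix a b assume "{a, b} \<in> T1 \<union> T2" "g a"
      thus "g b"
        using g g' network_edge[OF N(1) _ T(1)] network_edge[OF N(2) _ T(2)]
        by (metis UnE linked_edge linked_trans)
    qed (use g[OF st(1)] in simp)
    thus False using g[OF st(2)] n by simp
  qed
  thus ?R using F by (metis linked_insert spans_def)
next
  assume ?R
  thus ?L
  proof
    assume *: "spans V1 T1 \<and> spans V2 (insert {s, t} T2)"
    have st: "(s, t) \<in> linked (T1 \<union> T2)"
      using * N linked_mono[of T1 "T1 \<union> T2"] by (auto simp: spans_def network_def)
    have "spans (V1 \<union> V2) (insert {s, t} (T1 \<union> T2))"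
      using * spans_parallel_insert[OF N T] spans_insert_mono by blast
    thus ?L using linked_insert[OF st] by (simp add: spans_def)
  next
    assume *: "spans V1 (insert {s, t} T1) \<and> spans V2 T2"
    have st: "(s, t) \<in> linked (T1 \<union> T2)"
      using * N linked_mono[of T2 "T1 \<union> T2"] by (auto simp: spans_def network_def)
    have "spans (V1 \<union> V2) (insert {s, t} (T1 \<union> T2))"
      using * spans_parallel_insert[OF N T] spans_insert_mono by blast
    thus ?L using linked_insert[OF st] by (simp add: spans_def)
  qed
qed

section \<open>Spanning sets under series composition\<close>

lemma spans_series_insert_left:
  assumes N: "network s m V1 E1" "network m t V2 E2" "V1 \<inter> V2 = {m}"
    and T: "T1 \<subseteq> E1" "T2 \<subseteq> E2"
    and sp: "spans (V1 \<union> V2) (insert {s, t} (T1 \<union> T2))"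
  shows "spans V1 (insert {s, m} T1)"
proof (rule spans_retract[OF sp])
  \<comment> \<open>The second network collapses to \<open>m\<close>, which turns the outer edge
    \<open>{s, t}\<close> into \<open>{s, m}\<close>.\<close>
  let ?f = "\<lambda>x. if x \<in> V1 then x else m"
  have st: "s \<in> V1" "m \<in> V1" "t \<notin> V1" using N by (auto simp: network_def)
  have l: "(s, m) \<in> linked (insert {s, m} T1)" by (rule linked_edge) simp
  fix a b assume "{a, b} \<in> insert {s, t} (T1 \<union> T2)"
  then consider "{a, b} = {s, t}" | "{a, b} \<in> T1" | "{a, b} \<in> T2" by blast
  thus "(?f a, ?f b) \<in> linked (insert {s, m} T1)"
  proof cases
    case 1 thus ?thesis using st l linked_sym by (auto simp: doubleton_eq_iff)
  next
    case 2 thus ?thesis using network_edge[OF N(1) 2 T(1)] by (auto intro!: linked_edge)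
  next
    case 3
    have "?f a = m" "?f b = m" using network_edge[OF N(2) 3 T(2)] N(3) by auto
    thus ?thesis by auto
  qed
qed auto

lemma spans_series_left:
  assumes N: "network s m V1 E1" "network m t V2 E2" "V1 \<inter> V2 = {m}"
    and T: "T1 \<subseteq> E1" "T2 \<subseteq> E2"
    and sp: "spans (V1 \<union> V2) (T1 \<union> T2)"
  shows "spans V1 T1"
proof (rule spans_retract[OF sp])
  let ?f = "\<lambda>x. if x \<in> V1 then x else m"
  fix a b assume "{a, b} \<in> T1 \<union> T2"
  then consider "{a, b} \<in> T1" | "{a, b} \<in> T2" by blast
  thus "(?f a, ?f b) \<in> linked T1"
  proof cases
    case 1 thus ?thesis using network_edge[OF N(1) 1 T(1)] by (auto intro!: linked_edge)
  next
    case 2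
    have "?f a = m" "?f b = m" using network_edge[OF N(2) 2 T(2)] N(3) by auto
    thus ?thesis by auto
  qed
qed auto

lemma network_swap: "network s t V E \<Longrightarrow> network t s V E"
  by (auto simp: network_def)

lemma spans_series:
  assumes N: "network s m V1 E1" "network m t V2 E2" "V1 \<inter> V2 = {m}"
    and T: "T1 \<subseteq> E1" "T2 \<subseteq> E2"
  shows "spans (V1 \<union> V2) (T1 \<union> T2) \<longleftrightarrow> spans V1 T1 \<and> spans V2 T2"
proof
  assume *: "spans (V1 \<union> V2) (T1 \<union> T2)"
  hence "spans (V2 \<union> V1) (T2 \<union> T1)" by (simp add: Un_commute)
  thus "spans V1 T1 \<and> spans V2 T2"
    using spans_series_left[OF N T *] N(3)
      spans_series_left[OF network_swap[OF N(2)] network_swap[OF N(1)] _ T(2,1)]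
    by (simp add: Int_commute)
next
  assume "spans V1 T1 \<and> spans V2 T2"
  hence "spans V1 (T1 \<union> T2)" "spans V2 (T1 \<union> T2)"
    by (auto elim!: spans_linked intro!: linked_mono)
  thus "spans (V1 \<union> V2) (T1 \<union> T2)" using N spans_Un[of V1 _ V2 m] by (auto simp: network_def)
qed

text \<open>The edge \<open>{s, t}\<close> closes the series composition to a ring through
  \<open>m\<close>, so at most one of the two parts may fail to link its terminals. The right-hand
  side has the shape of \<open>spans_parallel\<close>, which makes trees and cuts dual.\<close>

lemma spans_series_insert:
  assumes N: "network s m V1 E1" "network m t V2 E2" "V1 \<inter> V2 = {m}"
    and T: "T1 \<subseteq> E1" "T2 \<subseteq> E2"
  shows "spans (V1 \<union> V2) (insert {s, t} (T1 \<union> T2)) \<longleftrightarrow>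
    spans V1 T1 \<and> spans V2 (insert {m, t} T2) \<or> spans V1 (insert {s, m} T1) \<and> spans V2 T2"
    (is "?L \<longleftrightarrow> ?R")
proof
  assume L: ?L
  hence L': "spans (V2 \<union> V1) (insert {t, s} (T2 \<union> T1))"
    by (simp add: Un_commute insert_commute)
  have F: "spans V1 (insert {s, m} T1)" "spans V2 (insert {m, t} T2)"
    using spans_series_insert_left[OF N T L] N(3)
      spans_series_insert_left[OF network_swap[OF N(2)] network_swap[OF N(1)] _ T(2,1) L']
    by (simp_all add: Int_commute insert_commute)
  have "(s, m) \<in> linked T1 \<or> (m, t) \<in> linked T2"
  proof (rule ccontr)
    assume n: "\<not> ?thesis"
    define g where "g x \<longleftrightarrow> x \<in> V1 \<and> (m, x) \<in> linked T1 \<or> x \<in> V2 \<and> (m, x) \<in> linked T2" for x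
    have g: "g x \<longleftrightarrow> (m, x) \<in> linked T1" if "x \<in> V1" for x
      unfolding g_def using that N(3) linked_refl[of m] by (metis Int_iff singletonD)
    have g': "g x \<longleftrightarrow> (m, x) \<in> linked T2" if "x \<in> V2" for x
      unfolding g_def using that N(3) linked_refl[of m] by (metis Int_iff singletonD)
    have st: "s \<in> V1" "m \<in> V1" "t \<in> V2" using N by (auto simp: network_def)
    \<comment> \<open>Neither end of \<open>{s, t}\<close> is reached from \<open>m\<close>, so this
      edge cannot break the closure of \<open>g\<close> and only edges of \<open>T1\<close> and
      \<open>T2\<close> have to be checked.\<close>
    have gst: "\<not> g s" "\<not> g t" using g[OF st(1)] g'[OF st(3)] n linked_sym[of m s] by auto
    from L st have "(m, s) \<in> linked (insert {s, t} (T1 \<union> T2))" by (auto simp: spans_def)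
    hence "g s"
    proof (rule linked_invariant)
      fix a b assume "{a, b} \<in> insert {s, t} (T1 \<union> T2)" "g a"
      hence "{a, b} \<in> T1 \<or> {a, b} \<in> T2" using gst by (auto simp: doubleton_eq_iff)
      thus "g b"
        using \<open>g a\<close> g g' network_edge[OF N(1) _ T(1)] network_edge[OF N(2) _ T(2)]
        by (metis linked_edge linked_trans)
    qed (use g[OF st(2)] in simp)
    thus False using gst by simp
  qed
  thus ?R using F by (metis linked_insert spans_def)
next
  have *: "spans (V1 \<union> V2) S" if "spans V1 S" "spans V2 S" for S
    using spans_Un[OF that, of m] N by (auto simp: network_def)
  let ?U = "insert {s, t} (T1 \<union> T2)"
  have st: "(s, t) \<in> linked ?U" by (rule linked_edge) simp
  have sub: "linked T1 \<subseteq> linked ?U" "linked T2 \<subseteq> linked ?U" by (auto intro!: linked_mono)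
  assume ?R
  thus ?L
  proof
    assume 1: "spans V1 T1 \<and> spans V2 (insert {m, t} T2)"
    hence "(s, m) \<in> linked ?U" using sub N(1) by (auto simp: spans_def network_def)
    hence "(m, t) \<in> linked ?U" using st linked_sym linked_trans by metis
    hence "linked (insert {m, t} T2) \<subseteq> linked ?U"
      using linked_insert[of m t ?U] linked_mono[of "insert {m, t} T2" "insert {m, t} ?U"] by blast
    thus ?L using 1 sub * spans_linked by blast
  next
    assume 1: "spans V1 (insert {s, m} T1) \<and> spans V2 T2"
    hence "(m, t) \<in> linked ?U" using sub N(2) by (auto simp: spans_def network_def)
    hence "(s, m) \<in> linked ?U" using st linked_sym linked_trans by metis
    hence "linked (insert {s, m} T1) \<subseteq> linked ?U"
      using linked_insert[of s m ?U] linked_mono[of "insert {s, m} T1" "insert {s, m} ?U"] by blast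
    thus ?L using 1 sub * spans_linked by blast
  qed
qed

section \<open>Tree and cut counts of composed networks\<close>

lemma network_parallel:
  "network s t V1 E1 \<Longrightarrow> network s t V2 E2 \<Longrightarrow> network s t (V1 \<union> V2) (E1 \<union> E2)"
  unfolding network_def by blast

lemma network_series:
  assumes "network s m V1 E1" "network m t V2 E2" "V1 \<inter> V2 = {m}"
  shows "network s t (V1 \<union> V2) (E1 \<union> E2)"
proof -
  have "s \<noteq> t" using assms unfolding network_def by blast
  thus ?thesis using assms unfolding network_def by blast
qed

text \<open>With conductance read as trees over cuts, dividing the two formulas says that
  conductances add in parallel.\<close>

lemma card_parallel:
  assumes N: "network s t V1 E1" "network s t V2 E2" "V1 \<inter> V2 = {s, t}" "E1 \<inter> E2 = {}"
  shows "card (trees (V1 \<union> V2) (E1 \<union> E2)) =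
      card (trees V1 E1) * card (cuts s t V2 E2) + card (cuts s t V1 E1) * card (trees V2 E2)"
    and "card (cuts s t (V1 \<union> V2) (E1 \<union> E2)) = card (cuts s t V1 E1) * card (cuts s t V2 E2)"
proof -
  show "card (trees (V1 \<union> V2) (E1 \<union> E2)) =
      card (trees V1 E1) * card (cuts s t V2 E2) + card (cuts s t V1 E1) * card (trees V2 E2)"
    by (rule card_mins_disj[OF N(4) network_finite[OF N(1)] network_finite[OF N(2)]
          spans_parallel[OF N(1-3)] mono_spans mono_spans
          network_exchange[OF N(1)] network_exchange[OF N(2)]])
  show "card (cuts s t (V1 \<union> V2) (E1 \<union> E2)) = card (cuts s t V1 E1) * card (cuts s t V2 E2)"
    by (rule card_mins_conj) (use N(4) spans_parallel_insert[OF N(1-3)] in auto)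
qed

text \<open>Dually, the quotients of cuts by trees, the resistances, add in series.\<close>

lemma card_series:
  assumes N: "network s m V1 E1" "network m t V2 E2" "V1 \<inter> V2 = {m}" "E1 \<inter> E2 = {}"
  shows "card (trees (V1 \<union> V2) (E1 \<union> E2)) = card (trees V1 E1) * card (trees V2 E2)"
    and "card (cuts s t (V1 \<union> V2) (E1 \<union> E2)) =
      card (trees V1 E1) * card (cuts m t V2 E2) + card (cuts s m V1 E1) * card (trees V2 E2)"
proof -
  show "card (cuts s t (V1 \<union> V2) (E1 \<union> E2)) =
      card (trees V1 E1) * card (cuts m t V2 E2) + card (cuts s m V1 E1) * card (trees V2 E2)"
    by (rule card_mins_disj[OF N(4) network_finite[OF N(1)] network_finite[OF N(2)]
          spans_series_insert[OF N(1-3)] mono_spans mono_spans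
          network_exchange[OF N(1)] network_exchange[OF N(2)]])
  show "card (trees (V1 \<union> V2) (E1 \<union> E2)) = card (trees V1 E1) * card (trees V2 E2)"
    by (rule card_mins_conj) (use N(4) spans_series[OF N(1-3)] in auto)
qed

lemma single_edge:
  assumes "s \<noteq> t"
  shows "trees {s, t} {{s, t}} = {{{s, t}}}" "cuts s t {s, t} {{s, t}} = {{}}"
proof -
  have e: "(s, t) \<in> linked {{s, t}}" by (rule linked_edge) simp
  have sp: "spans {s, t} {{s, t}}" by (rule spansI[of _ s]) (use e in auto)
  have n: "\<not> spans {s, t} {}" using assms by (auto simp: spans_def linked_def)
  show "trees {s, t} {{s, t}} = {{{s, t}}}"
    using sp n by (auto simp: mins_def subset_singleton_iff)
  show "cuts s t {s, t} {{s, t}} = {{}}"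
    using sp by (auto simp: mins_def subset_singleton_iff)
qed

section \<open>Straight-line drawings\<close>

text \<open>General position is maintained so that edges with a common end never overlap.\<close>

definition straight :: "('v \<Rightarrow> real ^ 2) \<Rightarrow> 'v set \<Rightarrow> 'v set set \<Rightarrow> bool" where
  "straight p V E \<longleftrightarrow> finite V \<and> inj_on p V \<and>
     (\<forall>a\<in>V. \<forall>b\<in>V. \<forall>c\<in>V. distinct [a, b, c] \<longrightarrow> \<not> collinear {p a, p b, p c}) \<and>
     (\<forall>a b. {a, b} \<in> E \<longrightarrow> a \<in> V \<and> b \<in> V \<and> a \<noteq> b) \<and>
     (\<forall>a b c d. {a, b} \<in> E \<longrightarrow> {c, d} \<in> E \<longrightarrow> {a, b} \<inter> {c, d} = {} \<longrightarrow>
        closed_segment (p a) (p b) \<inter> closed_segment (p c) (p d) = {})"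

lemma straight_subset:
  assumes "straight p V E" "F \<subseteq> E"
  shows "straight p V F"
proof -
  have E: "{a, b} \<in> E" if "{a, b} \<in> F" for a b using assms(2) that by blast
  have "\<forall>a b. {a, b} \<in> F \<longrightarrow> a \<in> V \<and> b \<in> V \<and> a \<noteq> b"
    using assms(1) E unfolding straight_def by metis
  moreover have "\<forall>a b c d. {a, b} \<in> F \<longrightarrow> {c, d} \<in> F \<longrightarrow> {a, b} \<inter> {c, d} = {} \<longrightarrow>
      closed_segment (p a) (p b) \<inter> closed_segment (p c) (p d) = {}"
    using assms(1) E unfolding straight_def by metis
  ultimately show ?thesis using assms(1) unfolding straight_def by (elim conjE, intro conjI)
qed

lemma straight_general:
  "straight p V E \<Longrightarrow> a \<in> V \<Longrightarrow> b \<in> V \<Longrightarrow> c \<in> V \<Longrightarrow> distinct [a, b, c] \<Longrightarrow> \<not> collinear {p a, p b, p c}"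
  by (simp add: straight_def)

lemma straight_disjoint:
  "straight p V E \<Longrightarrow> {a, b} \<in> E \<Longrightarrow> {c, d} \<in> E \<Longrightarrow> {a, b} \<inter> {c, d} = {} \<Longrightarrow>
    closed_segment (p a) (p b) \<inter> closed_segment (p c) (p d) = {}"
  by (simp add: straight_def)

lemma straight_adjacent:
  assumes "straight p V E" "a \<in> V" "b \<in> V" "c \<in> V" "distinct [a, b, c]"
  shows "closed_segment (p a) (p b) \<inter> closed_segment (p b) (p c) = {p b}"
  using assms by (intro Int_closed_segment) (auto simp: straight_def)

text \<open>Disjoint compact sets have a positive distance \<open>d\<close>, and moving one end of a
  segment by less than \<open>d\<close> moves each of its points by less than
  \<open>d\<close>.\<close>

lemma segment_disjoint_near:
  fixes a m :: "'a::euclidean_space"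
  assumes "compact K" "closed_segment a m \<inter> K = {}"
  shows "\<forall>\<^sub>F y in nhds m. closed_segment a y \<inter> K = {}"
proof -
  obtain d where d: "d > 0" "\<And>x y. x \<in> closed_segment a m \<Longrightarrow> y \<in> K \<Longrightarrow> d \<le> dist x y"
    using separate_compact_closed[of "closed_segment a m" K] assms compact_imp_closed by (metis compact_segment)
  have "closed_segment a y \<inter> K = {}" if "dist y m < d" for y
  proof (rule ccontr)
    assume "\<not> ?thesis"
    then obtain z u where z: "z \<in> K" "0 \<le> u" "u \<le> 1" "z = (1 - u) *\<^sub>R a + u *\<^sub>R y"
      by (auto simp: closed_segment_def)
    let ?z = "(1 - u) *\<^sub>R a + u *\<^sub>R m"
    have "d \<le> dist ?z z"
      using z by (intro d(2)) (auto simp: closed_segment_def)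
    also have "dist ?z z = u * dist y m"
    proof -
      have "?z - z = u *\<^sub>R (m - y)" using z(4) by (simp add: algebra_simps)
      thus ?thesis using z(2) by (simp add: dist_norm norm_minus_commute)
    qed
    also have "\<dots> \<le> 1 * dist y m" using z by (intro mult_right_mono) auto
    finally show False using that by simp
  qed
  thus ?thesis unfolding eventually_nhds_metric using d(1) by blast
qed

text \<open>Finitely many lines in the plane form a closed set without interior, so they cannot
  cover a neighbourhood of \<open>m\<close>.\<close>

lemma ex_not_on_lines:
  fixes m :: "real ^ 2"
  assumes "\<forall>\<^sub>F y in nhds m. P y" "finite L"
  obtains y where "P y" "\<And>a b. (a, b) \<in> L \<Longrightarrow> y \<notin> affine hull {a, b}"
proof -
  define U where "U = (\<Union>(a, b)\<in>L. affine hull {a, b})"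
  have "closed U \<and> interior U = {}"
    unfolding U_def using assms(2)
  proof (induction rule: finite_induct)
    case (insert l L)
    obtain a b where l: "l = (a, b)" by (cases l)
    have "card {a, b} \<le> DIM(real ^ 2)"
      using card_insert_le_m1[of 2 "{b}" a] by simp
    hence "interior (affine hull {a, b}) = {}" by (intro empty_interior_affine_hull) auto
    moreover have "closed (affine hull {a, b})" by (simp add: affine_closed)
    ultimately show ?case using insert l by (auto simp: interior_closed_Un_empty_interior)
  qed simp
  moreover obtain S where S: "open S" "m \<in> S" "\<And>y. y \<in> S \<Longrightarrow> P y"
    using assms(1) by (auto simp: eventually_nhds)
  ultimately have "\<not> S \<subseteq> U" using interior_maximal[of S U] by auto
  then obtain y where "y \<in> S" "y \<notin> U" by blast
  with S(3) show thesis using that[of y] by (auto simp: U_def)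
qed

text \<open>If the new vertex sat at the midpoint of the edge, its two new edges would run along
  that edge and meet only what the edge meets. A small move keeps the required disjointness and can
  avoid every line through two drawn vertices.\<close>

lemma straight_ear:
  assumes p: "straight p V E" and uv: "{u, v} \<in> E" and x: "x \<notin> V"
  shows "\<exists>y. straight (p(x := y)) (insert x V) (insert {u, x} (insert {x, v} E))"
proof -
  have V: "u \<in> V" "v \<in> V" "u \<noteq> v" "finite V" "inj_on p V" using p uv by (auto simp: straight_def)
  have EV: "a \<in> V" "b \<in> V" "a \<noteq> b" if "{a, b} \<in> E" for a b
    using p that unfolding straight_def by blast+
  define m where "m = midpoint (p u) (p v)"
  define D where "D = {(a, b). {a, b} \<in> E}"
  have finD: "finite D" by (rule finite_subset[of _ "V \<times> V"]) (use V EV in \<open>auto simp: D_def\<close>)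
  have puv: "p u \<noteq> p v" using V by (auto simp: inj_on_def)
  have m: "m \<in> closed_segment (p u) (p v)" by (simp add: m_def)
  \<comment> \<open>An edge at the far end \<open>r'\<close> touches the segment from
    \<open>r\<close> to \<open>r'\<close> only in \<open>p r'\<close>, and the half ending at
    \<open>m\<close> does not reach that point.\<close>
  have half: "closed_segment (p r) m \<inter> closed_segment (p a) (p b) = {}"
    if r: "{r, r'} = {u, v}" and ab: "{a, b} \<in> E" "r \<notin> {a, b}" for r r' a b
  proof -
    have m': "m \<in> closed_segment (p r) (p r')" using m r by (auto simp: doubleton_eq_iff closed_segment_commute)
    hence sub: "closed_segment (p r) m \<subseteq> closed_segment (p r) (p r')"
      by (simp add: subset_closed_segment)
    have rr: "r \<in> V" "r' \<in> V" "r \<noteq> r'" "{r, r'} \<in> E" using r V uv by (auto simp: doubleton_eq_iff insert_commute)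
    have nr': "p r' \<notin> closed_segment (p r) m"
    proof
      assume "p r' \<in> closed_segment (p r) m"
      hence "dist (p r) (p r') \<le> dist (p r) m" using dist_in_closed_segment by (metis dist_commute)
      moreover have "dist (p r) m = dist (p r) (p r') / 2"
        using r by (auto simp: m_def doubleton_eq_iff dist_midpoint dist_commute)
      moreover have "dist (p r) (p r') > 0" using rr V(5) by (auto simp: inj_on_def)
      ultimately show False by simp
    qed
    show ?thesis
    proof (cases "r' \<in> {a, b}")
      case False
      hence "closed_segment (p r) (p r') \<inter> closed_segment (p a) (p b) = {}"
        using False ab by (intro straight_disjoint[OF p rr(4) ab(1)]) blast
      thus ?thesis using sub by blast
    next
      case True
      then obtain c where c: "{a, b} = {r', c}" by blast
      hence cE: "{r', c} \<in> E" "c \<noteq> r" using ab by auto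
      have "closed_segment (p r) (p r') \<inter> closed_segment (p r') (p c) = {p r'}"
        using rr EV[OF cE(1)] cE(2) by (intro straight_adjacent[OF p]) auto
      hence "closed_segment (p r) m \<inter> closed_segment (p r') (p c) \<subseteq> {p r'}"
        using Int_mono[OF sub order_refl] by metis
      hence "closed_segment (p r) m \<inter> closed_segment (p r') (p c) = {}"
        using nr' by (auto dest: subset_singletonD)
      moreover have eq: "closed_segment (p a) (p b) = closed_segment (p r') (p c)"
        using c by (auto simp: doubleton_eq_iff closed_segment_commute)
      ultimately show ?thesis by (metis eq)
    qed
  qed
  \<comment> \<open>Only edges avoiding the respective end are constrained; edges that share an end
    are controlled by general position.\<close>
  define Q where "Q y \<longleftrightarrow> (\<forall>(a, b)\<in>D. (u \<notin> {a, b} \<longrightarrow> closed_segment (p u) y \<inter> closed_segment (p a) (p b) = {})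
    \<and> (v \<notin> {a, b} \<longrightarrow> closed_segment (p v) y \<inter> closed_segment (p a) (p b) = {}))" for y
  have ev: "\<forall>\<^sub>F y in nhds m. Q y"
    unfolding Q_def
  proof (rule eventually_ball_finite[OF finD], clarify, intro eventually_conj)
    fix a b assume "(a, b) \<in> D"
    hence ab: "{a, b} \<in> E" by (simp add: D_def)
    have vu: "{v, u} = {u, v}" by blast
    show "\<forall>\<^sub>F y in nhds m. u \<notin> {a, b} \<longrightarrow> closed_segment (p u) y \<inter> closed_segment (p a) (p b) = {}"
      using segment_disjoint_near[OF compact_segment half[OF refl ab]] by (cases "u \<in> {a, b}") auto
    show "\<forall>\<^sub>F y in nhds m. v \<notin> {a, b} \<longrightarrow> closed_segment (p v) y \<inter> closed_segment (p a) (p b) = {}"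
      using segment_disjoint_near[OF compact_segment half[OF vu ab]] by (cases "v \<in> {a, b}") auto
  qed
  have fin: "finite (p ` V \<times> p ` V)" using V(4) by simp
  obtain y where y: "Q y" "\<And>a b. (a, b) \<in> p ` V \<times> p ` V \<Longrightarrow> y \<notin> affine hull {a, b}"
    using ex_not_on_lines[OF ev fin] by metis
  let ?p = "p(x := y)"
  have px: "?p a = p a" if "a \<in> V" for a using that x by auto
  \<comment> \<open>A diagonal pair has a single point as its affine hull, so avoiding all hulls
    also keeps \<open>y\<close> off the old vertices.\<close>
  have yV: "y \<noteq> p a" if "a \<in> V" for a using y(2)[of "p a" "p a"] that by auto
  have gen: "\<not> collinear {p a, p b, y}" if "a \<in> V" "b \<in> V" "a \<noteq> b" for a b
  proof -
    have "p a \<noteq> p b" using that V(5) by (auto simp: inj_on_def)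
    hence "collinear {p a, p b, y} \<longleftrightarrow> y \<in> affine hull {p a, p b}" by (rule collinear_3_affine_hull)
    moreover have "y \<notin> affine hull {p a, p b}" using that by (intro y(2)) simp
    ultimately show ?thesis by simp
  qed
  have gen': "\<not> collinear {p a, y, p b}" "\<not> collinear {y, p a, p b}" if "a \<in> V" "b \<in> V" "a \<noteq> b" for a b
    using gen[OF that] insert_commute[of y "p a" "{p b}"] insert_commute[of y "p b" "{}"] by simp_all
  have G: "\<not> collinear {?p a, ?p b, ?p c}"
    if "a \<in> insert x V" "b \<in> insert x V" "c \<in> insert x V" "distinct [a, b, c]" for a b c
  proof -
    have 0: "\<not> collinear {p a, p b, p c}" if "a \<in> V" "b \<in> V" "c \<in> V" "distinct [a, b, c]"
      using straight_general[OF p that] .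
    show ?thesis
      using that gen[of a b] gen'[of a c] gen'[of b c] 0 px by (cases "a = x"; cases "b = x"; cases "c = x") simp_all
  qed
  have ux: "closed_segment y (p r) \<inter> closed_segment (p a) (p b) = {}"
    if "r \<in> {u, v}" "{a, b} \<in> E" "r \<notin> {a, b}" for r a b
  proof -
    have "u \<notin> {a, b} \<Longrightarrow> closed_segment y (p u) \<inter> closed_segment (p a) (p b) = {}"
      "v \<notin> {a, b} \<Longrightarrow> closed_segment y (p v) \<inter> closed_segment (p a) (p b) = {}"
      using y(1) that(2) unfolding Q_def D_def closed_segment_commute[of y] by simp_all
    thus ?thesis using that(1,3) by (elim insertE) simp_all
  qed
  have disj: "closed_segment (?p a) (?p b) \<inter> closed_segment (?p c) (?p d) = {}"
    if ab: "{a, b} \<in> insert {u, x} (insert {x, v} E)" and cd: "{c, d} \<in> insert {u, x} (insert {x, v} E)"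
      and dis: "{a, b} \<inter> {c, d} = {}" for a b c d
  proof -
    have new: "\<exists>r\<in>{u, v}. {a, b} = {x, r} \<and> closed_segment (?p a) (?p b) = closed_segment y (p r)"
      if "{a, b} \<in> insert {u, x} (insert {x, v} E)" "{a, b} \<notin> E" for a b
      using that x V by (auto simp: doubleton_eq_iff closed_segment_commute)
    have old: "closed_segment (?p a) (?p b) = closed_segment (p a) (p b)" if "{a, b} \<in> E" for a b
      using EV[OF that] px by simp
    consider "{a, b} \<in> E" "{c, d} \<in> E" | "{a, b} \<in> E" "{c, d} \<notin> E" | "{a, b} \<notin> E" "{c, d} \<in> E"
      | "{a, b} \<notin> E" "{c, d} \<notin> E" by blast
    thus ?thesis
    proof cases
      case 1
      show ?thesis unfolding old[OF 1(1)] old[OF 1(2)] by (rule straight_disjoint[OF p 1 dis])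
    next
      case 2
      then obtain r where "r \<in> {u, v}" "{c, d} = {x, r}" "closed_segment (?p c) (?p d) = closed_segment y (p r)"
        using new[OF cd] by blast
      thus ?thesis using ux[of r a b] 2 dis unfolding old[OF 2(1)] by blast
    next
      case 3
      then obtain r where "r \<in> {u, v}" "{a, b} = {x, r}" "closed_segment (?p a) (?p b) = closed_segment y (p r)"
        using new[OF ab] by blast
      thus ?thesis using ux[of r c d] 3 dis unfolding old[OF 3(2)] by blast
    next
      case 4
      have "x \<in> {a, b}" "x \<in> {c, d}" using new[OF ab 4(1)] new[OF cd 4(2)] by (metis insertI1)+
      thus ?thesis using dis by (metis disjoint_iff)
    qed
  qed
  have ends: "a \<in> insert x V" "b \<in> insert x V" "a \<noteq> b"
    if "{a, b} \<in> insert {u, x} (insert {x, v} E)" for a b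
    using that EV[of a b] V x by (auto simp: doubleton_eq_iff)
  have "straight ?p (insert x V) (insert {u, x} (insert {x, v} E))"
    unfolding straight_def
  proof (intro conjI ballI allI impI)
    show "finite (insert x V)" using V(4) by simp
    show "inj_on ?p (insert x V)" using V(5) yV x by (auto simp: inj_on_def)
  qed (fact G ends disj)+
  thus ?thesis by blast
qed

lemma straight_edge: "s \<noteq> t \<Longrightarrow> \<exists>p. straight p {s, t} {{s, t}}"
proof -
  assume "s \<noteq> t"
  moreover have "axis 1 1 \<noteq> (0 :: real ^ 2)" by (simp add: axis_eq_0_iff)
  ultimately have "straight (\<lambda>x. if x = s then axis 1 1 else 0) {s, t} {{s, t}}"
    unfolding straight_def by (auto simp: inj_on_def doubleton_eq_iff)
  thus ?thesis by blast
qed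

text \<open>General position keeps vertices out of the interiors of edges and makes two edges with a
  common end meet only there. Edges without a common end are disjoint by
  \<open>straight\<close>.\<close>

lemma planar_straight:
  assumes p: "straight p (verts G) (ends G ` edges G)" and inj: "inj_on (ends G) (edges G)"
    and card: "\<And>e. e \<in> edges G \<Longrightarrow> card (ends G e) = 2"
  shows "planar G"
proof -
  have "\<forall>e. \<exists>a b. e \<in> edges G \<longrightarrow> ends G e = {a, b}"
    using card by (metis card_2_iff)
  then obtain a b where ab: "\<And>e. e \<in> edges G \<Longrightarrow> ends G e = {a e, b e}" by metis
  have V: "a e \<in> verts G" "b e \<in> verts G" "a e \<noteq> b e" if "e \<in> edges G" for e
    using p ab[OF that] that unfolding straight_def by (metis imageI)+
  define c where "c e = linepath (p (a e)) (p (b e))" for e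
  have "plane_drawing G p c"
    unfolding plane_drawing_def
  proof (intro conjI ballI impI)
    show inj': "inj_on p (verts G)" using p by (simp add: straight_def)
    fix e assume e: "e \<in> edges G"
    show "arc (c e)" using inj' V[OF e] unfolding c_def by (intro arc_linepath) (auto simp: inj_on_def)
    show "{pathstart (c e), pathfinish (c e)} = p ` ends G e" by (simp add: c_def ab e)
    have "w \<in> {a e, b e}" if "w \<in> verts G" "p w \<in> closed_segment (p (a e)) (p (b e))" for w
    proof (rule ccontr)
      assume "w \<notin> {a e, b e}"
      hence "\<not> collinear {p (a e), p w, p (b e)}"
        using V[OF e] that(1) by (intro straight_general[OF p]) auto
      moreover have "between (p (a e), p (b e)) (p w)" using that(2) by (simp add: between_mem_segment)
      hence "collinear {p (a e), p w, p (b e)}" by (rule between_imp_collinear)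
      ultimately show False by simp
    qed
    thus "(path_image (c e) - p ` ends G e) \<inter> p ` verts G = {}"
      by (auto simp: c_def ab e)
    fix f assume f: "f \<in> edges G" "f \<noteq> e"
    hence ne: "{a e, b e} \<noteq> {a f, b f}" using inj e ab by (auto simp: inj_on_def)
    have "closed_segment (p (a e)) (p (b e)) \<inter> closed_segment (p (a f)) (p (b f)) \<subseteq> {p (a e), p (b e)}"
    proof (cases "{a e, b e} \<inter> {a f, b f} = {}")
      case True
      have "{a e, b e} \<in> ends G ` edges G" "{a f, b f} \<in> ends G ` edges G"
        using e f ab by (metis imageI)+
      from straight_disjoint[OF p this True] show ?thesis by simp
    next
      case False
      then obtain r where "r \<in> {a e, b e}" "r \<in> {a f, b f}" by blast
      then obtain r' r'' where r: "{a e, b e} = {r, r'}" "{a f, b f} = {r, r''}"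
        by (metis insert_iff insert_commute singletonD)
      hence d: "distinct [r', r, r'']" "r \<in> verts G" "r' \<in> verts G" "r'' \<in> verts G"
        using ne V[OF e] V[OF f(1)] by (auto simp: doubleton_eq_iff)
      have eqs: "closed_segment (p (a e)) (p (b e)) = closed_segment (p r') (p r)"
        "closed_segment (p (a f)) (p (b f)) = closed_segment (p r) (p r'')"
        using r by (auto simp: doubleton_eq_iff closed_segment_commute)
      have "p r \<in> {p (a e), p (b e)}" using r by (auto simp: doubleton_eq_iff)
      thus ?thesis unfolding eqs straight_adjacent[OF p d(3,2,4,1)] by simp
    qed
    thus "(path_image (c e) - p ` ends G e) \<inter> path_image (c f) = {}"
      by (simp only: c_def path_image_linepath ab[OF e] image_insert image_empty) blast
  qed
  thus ?thesis by (auto simp: planar_def)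
qed

section \<open>Counting spanning trees of multigraphs\<close>

lemma connected_mgraph_iff:
  "connected_mgraph G \<longleftrightarrow> verts G \<noteq> {} \<and> spans (verts G) (ends G ` edges G)"
proof -
  have "{(x, y). \<exists>e\<in>edges G. ends G e = {x, y}} = {(x, y). {x, y} \<in> ends G ` edges G}"
    by (auto simp: image_iff eq_commute)
  thus ?thesis by (simp add: connected_mgraph_def spans_def linked_def)
qed

lemma linked_path:
  assumes "(u, v) \<in> linked T"
  obtains xs where "xs \<noteq> []" "xs ! 0 = u" "xs ! (length xs - 1) = v" "distinct xs"
    "\<And>i. Suc i < length xs \<Longrightarrow> {xs ! i, xs ! Suc i} \<in> T"
proof -
  have "\<exists>xs. xs \<noteq> [] \<and> xs ! 0 = u \<and> xs ! (length xs - 1) = v \<and> distinct xs \<and>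
      (\<forall>i. Suc i < length xs \<longrightarrow> {xs ! i, xs ! Suc i} \<in> T)"
    using assms unfolding linked_def
  proof (induction rule: rtrancl_induct)
    case base
    show ?case by (rule exI[of _ "[u]"]) simp
  next
    case (step y z)
    then obtain xs where xs: "xs \<noteq> []" "xs ! 0 = u" "xs ! (length xs - 1) = y" "distinct xs"
      "\<And>i. Suc i < length xs \<Longrightarrow> {xs ! i, xs ! Suc i} \<in> T" by blast
    show ?case
    proof (cases "z \<in> set xs")
      \<comment> \<open>The path returns to \<open>z\<close>, so it is cut back to the earlier
        occurrence and its vertices stay distinct.\<close>
      case True
      then obtain j where j: "j < length xs" "xs ! j = z" by (auto simp: in_set_conv_nth)
      hence "length (take (Suc j) xs) = Suc j" by simp
      thus ?thesis
        by (intro exI[of _ "take (Suc j) xs"]) (use j xs in auto)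
    next
      case False
      have "{(xs @ [z]) ! i, (xs @ [z]) ! Suc i} \<in> T" if "Suc i < length (xs @ [z])" for i
      proof (cases "Suc i < length xs")
        case True
        thus ?thesis using xs(5)[of i] by (simp add: nth_append)
      next
        case False
        hence "i = length xs - 1" "Suc i = length xs" using that xs(1) by auto
        thus ?thesis using xs(1,3) step.hyps(2) by (simp add: nth_append)
      qed
      thus ?thesis
        by (intro exI[of _ "xs @ [z]"]) (use xs False in \<open>auto simp: nth_append\<close>)
    qed
  qed
  thus thesis using that by blast
qed

text \<open>The last edge of the cycle closes it from \<open>vs ! n\<close> to
  \<open>vs ! 0\<close>. The other edges of the cycle link these two vertices already.\<close>

lemma cycle_imp_redundant:
  assumes "is_cycle G vs es" "spans V (ends G ` edges G)"
  shows "\<exists>e\<in>edges G. spans V (ends G ` (edges G - {e}))"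
proof -
  define n where "n = length es - 1"
  have n: "length es = Suc n" using assms(1) unfolding is_cycle_def n_def by linarith
  have c: "length vs = Suc n" "length es = Suc n" "distinct es" "set es \<subseteq> edges G"
    "\<And>i. i < Suc n \<Longrightarrow> ends G (es ! i) = {vs ! i, vs ! (Suc i mod Suc n)}"
    using assms(1) unfolding is_cycle_def n by simp_all
  let ?T = "ends G ` (edges G - {es ! n})"
  have "(vs ! 0, vs ! i) \<in> linked ?T" if "i \<le> n" for i
    using that
  proof (induction i)
    case (Suc i)
    have "es ! i \<in> edges G - {es ! n}"
      using c Suc.prems by (auto simp: nth_eq_iff_index_eq)
    moreover have "ends G (es ! i) = {vs ! i, vs ! Suc i}" using c(5)[of i] Suc.prems by simp
    ultimately have "{vs ! i, vs ! Suc i} \<in> ?T" by (metis imageI)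
    thus ?case using Suc linked_edge linked_trans by (metis Suc_leD)
  qed simp
  hence l: "(vs ! 0, vs ! n) \<in> linked ?T" by simp
  have e: "ends G (es ! n) = {vs ! n, vs ! 0}" using c(5)[of n] by simp
  have "linked (ends G ` edges G) \<subseteq> linked ?T"
  proof (rule linked_subset)
    fix a b assume "{a, b} \<in> ends G ` edges G"
    then obtain f where f: "f \<in> edges G" "ends G f = {a, b}" by auto
    show "(a, b) \<in> linked ?T"
    proof (cases "f = es ! n")
      case True
      with f e have "{a, b} = {vs ! n, vs ! 0}" by simp
      thus ?thesis using l linked_sym by (auto simp: doubleton_eq_iff)
    next
      case False
      with f have "{a, b} \<in> ?T" by (metis DiffI imageI singletonD)
      thus ?thesis by (rule linked_edge)
    qed
  qed
  moreover have "es ! n \<in> edges G" using c by auto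
  ultimately show ?thesis using spans_linked[OF assms(2)] by blast
qed

text \<open>A path between the ends of \<open>e\<close> that avoids \<open>e\<close> closes up with
  \<open>e\<close>. If the path is a single edge, this is the cycle of length 2 formed by two
  parallel edges.\<close>

lemma redundant_imp_cycle:
  assumes e: "e \<in> edges G" and E: "\<And>f. f \<in> edges G \<Longrightarrow> ends G f \<subseteq> verts G \<and> card (ends G f) = 2"
    and sp: "spans (verts G) (ends G ` (edges G - {e}))"
  shows "\<exists>vs es. is_cycle G vs es"
proof -
  obtain u v where uv: "ends G e = {u, v}" "u \<noteq> v" using E[OF e] by (auto simp: card_2_iff)
  have V: "u \<in> verts G" "v \<in> verts G" using E[OF e] uv by auto
  with sp have "(u, v) \<in> linked (ends G ` (edges G - {e}))" by (auto simp: spans_def)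
  then obtain xs where xs: "xs \<noteq> []" "xs ! 0 = u" "xs ! (length xs - 1) = v" "distinct xs"
    "\<And>i. Suc i < length xs \<Longrightarrow> {xs ! i, xs ! Suc i} \<in> ends G ` (edges G - {e})"
    by (rule linked_path) blast
  define n where "n = length xs - 1"
  have n: "length xs = Suc n" "n > 0" using xs uv(2) by (cases xs; fastforce simp: n_def)+
  have "\<forall>i. \<exists>f. i < n \<longrightarrow> f \<in> edges G - {e} \<and> ends G f = {xs ! i, xs ! Suc i}"
    using xs(5) n(1) by (metis (no_types, lifting) Suc_mono imageE)
  then obtain f where f: "\<And>i. i < n \<Longrightarrow> f i \<in> edges G - {e} \<and> ends G (f i) = {xs ! i, xs ! Suc i}"
    by metis
  define es where "es = map f [0..<n] @ [e]"
  have es: "es ! i = f i" if "i < n" for i using that by (simp add: es_def nth_append)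
  have esn: "es ! n = e" by (simp add: es_def nth_append)
  have "inj_on f {0..<n}"
  proof (rule inj_onI)
    fix i j assume ij: "i \<in> {0..<n}" "j \<in> {0..<n}" "f i = f j"
    hence "{xs ! i, xs ! Suc i} = {xs ! j, xs ! Suc j}" using f[of i] f[of j] by auto
    \<comment> \<open>The vertices of the path are distinct, so equal pairs of consecutive vertices
      agree either in order or crosswise, and crosswise is absurd.\<close>
    hence "i = j \<or> i = Suc j \<and> Suc i = j"
      using ij n(1) xs(4) by (auto simp: doubleton_eq_iff nth_eq_iff_index_eq)
    thus "i = j" by auto
  qed
  moreover have "e \<notin> f ` {0..<n}" using f by fastforce
  ultimately have dist: "distinct es" by (auto simp: es_def distinct_map)
  have "xs ! i \<in> verts G" if "i < length xs" for i
  proof (cases "i < n")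
    case True
    thus ?thesis using f[OF True] E by blast
  next
    case False
    hence "i = n" using that n by simp
    thus ?thesis using xs(3) V by (simp add: n_def)
  qed
  hence "set xs \<subseteq> verts G" by (auto simp: in_set_conv_nth)
  moreover have "ends G (es ! i) = {xs ! i, xs ! (Suc i mod length es)}" if "i < length es" for i
  proof (cases "i < n")
    case True
    thus ?thesis using f[OF True] es by (simp add: es_def)
  next
    case False
    hence "i = n" using that by (simp add: es_def)
    thus ?thesis using esn uv xs(2,3) by (simp add: es_def n_def insert_commute)
  qed
  moreover have "set es \<subseteq> edges G" using f e by (auto simp: es_def)
  ultimately have "is_cycle G xs es"
    unfolding is_cycle_def using dist xs(4) n by (simp add: es_def)
  thus ?thesis by blast
qed

text \<open>For an edge set that spans, containing a cycle and having a removable edge are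
  equivalent by the two preceding lemmas.\<close>

lemma num_spanning_trees_eq_mins:
  assumes "verts G \<noteq> {}" "\<And>f. f \<in> edges G \<Longrightarrow> ends G f \<subseteq> verts G \<and> card (ends G f) = 2"
  shows "num_spanning_trees G = card (mins (\<lambda>T. spans (verts G) (ends G ` T)) (edges G))"
proof -
  have "is_tree (G\<lparr>edges := T\<rparr>) \<longleftrightarrow>
      spans (verts G) (ends G ` T) \<and> (\<forall>e\<in>T. \<not> spans (verts G) (ends G ` (T - {e})))"
    if T: "T \<subseteq> edges G" for T
    using cycle_imp_redundant[of "G\<lparr>edges := T\<rparr>" _ _ "verts G"]
      redundant_imp_cycle[of _ "G\<lparr>edges := T\<rparr>"] assms T
    unfolding is_tree_def connected_mgraph_iff by simp blast
  thus ?thesis unfolding num_spanning_trees_def mins_def by (intro arg_cong[of _ _ card]) blast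
qed

text \<open>Deletion and contraction of \<open>e\<close> keep the same edges, and linking in the
  contraction amounts to linking in \<open>G\<close> with \<open>{s, t}\<close> added. The
  contraction may have parallel edges, so named edges are replaced by pairs only after its ends have
  been translated back to those of \<open>G\<close>.\<close>

lemma simple_mgraph_counts:
  assumes G: "simple_mgraph G" and e: "e \<in> edges G" "ends G e = {s, t}"
  shows "num_spanning_trees (delete_edge G e) = card (trees (verts G) (ends G ` (edges G - {e})))"
    and "num_spanning_trees (contract_edge G e) = card (cuts s t (verts G) (ends G ` (edges G - {e})))"
proof -
  have G': "verts G \<noteq> {}" "\<And>f. f \<in> edges G \<Longrightarrow> ends G f \<subseteq> verts G \<and> card (ends G f) = 2"
    "inj_on (ends G) (edges G)"
    using G by (auto simp: simple_mgraph_def loopless_mgraph_def)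
  have inj: "inj_on (ends G) (edges G - {e})" by (rule inj_on_subset[OF G'(3)]) auto
  have "num_spanning_trees (delete_edge G e) =
      card (mins (\<lambda>T. spans (verts G) (ends G ` T)) (edges G - {e}))"
    using num_spanning_trees_eq_mins[of "delete_edge G e"] G' by (simp add: delete_edge_def)
  thus "num_spanning_trees (delete_edge G e) = card (trees (verts G) (ends G ` (edges G - {e})))"
    using card_mins_image[OF inj] by metis
  let ?M = "merge_block G e"
  have M: "?M x = (if x \<in> {s, t} then {s, t} else {x})" for x by (simp add: merge_block_def e)
  have st: "s \<noteq> t" using G'(2)[OF e(1)] e(2) by auto
  \<comment> \<open>Since \<open>G\<close> is simple, no other edge joins \<open>s\<close> and
    \<open>t\<close>, so contraction discards \<open>e\<close> alone.\<close>
  have two: "card (?M ` ends G f) = 2 \<longleftrightarrow> f \<noteq> e" if f: "f \<in> edges G" for f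
  proof (cases "f = e")
    case True
    have "?M ` {s, t} = {{s, t}}" by (simp add: M)
    thus ?thesis using True by (simp add: e)
  next
    case False
    obtain a b where ab: "ends G f = {a, b}" "a \<noteq> b"
      using G'(2)[OF f] by (auto simp: card_2_iff)
    have "{a, b} \<noteq> {s, t}" using False f e ab(1) G'(3) by (metis inj_onD)
    hence "?M a \<noteq> ?M b" using ab(2) st unfolding M by auto
    thus ?thesis using False by (simp add: ab(1))
  qed
  have edges: "edges (contract_edge G e) = edges G - {e}"
    using two by (auto simp: contract_edge_def)
  have "num_spanning_trees (contract_edge G e) =
      card (mins (\<lambda>T. spans (?M ` verts G) ((\<lambda>f. ?M ` ends G f) ` T)) (edges G - {e}))"
    using num_spanning_trees_eq_mins[of "contract_edge G e"] G' edges
    by (simp add: contract_edge_def image_mono)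
  also have "mins (\<lambda>T. spans (?M ` verts G) ((\<lambda>f. ?M ` ends G f) ` T)) (edges G - {e}) =
      mins (\<lambda>T. spans (verts G) (insert {s, t} (ends G ` T))) (edges G - {e})"
  proof (rule mins_cong)
    fix T assume T: "T \<subseteq> edges G - {e}"
    let ?S = "(\<lambda>f. ?M ` ends G f) ` T" and ?U = "insert {s, t} (ends G ` T)"
    have 1: "(?M a, ?M b) \<in> linked ?S" if "(a, b) \<in> linked ?U" for a b
    proof (rule linked_map[OF that])
      fix a b assume "{a, b} \<in> ?U"
      thus "(?M a, ?M b) \<in> linked ?S"
      proof
        assume "{a, b} = {s, t}"
        hence "?M a = ?M b" by (auto simp: M doubleton_eq_iff)
        thus ?thesis by simp
      next
        assume "{a, b} \<in> ends G ` T"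
        then obtain f where "f \<in> T" "ends G f = {a, b}" by auto
        hence "{?M a, ?M b} \<in> ?S" by force
        thus ?thesis by (rule linked_edge)
      qed
    qed
    \<comment> \<open>The way back from blocks to vertices picks a representative of each block. It
      is linked to every member of its block, if need be through \<open>{s, t}\<close>.\<close>
    define r where "r X = (SOME x. x \<in> X)" for X :: "'a set"
    have "a \<in> ?M a" for a by (simp add: M)
    hence "r (?M a) \<in> ?M a" for a unfolding r_def by (metis someI_ex)
    moreover have "(x, a) \<in> linked ?U" if "x \<in> ?M a" for x a
      using that linked_edge[of s t ?U] linked_sym by (auto simp: M split: if_splits)
    ultimately have r: "(r (?M a), a) \<in> linked ?U" for a by blast
    have 2: "(a, b) \<in> linked ?U" if "(?M a, ?M b) \<in> linked ?S" for a b
    proof -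
      have "(r (?M a), r (?M b)) \<in> linked ?U"
      proof (rule linked_map[OF that])
        fix A B assume "{A, B} \<in> ?S"
        then obtain f where f: "f \<in> T" "{A, B} = ?M ` ends G f" by auto
        obtain a b where ab: "ends G f = {a, b}" using G'(2)[of f] f(1) T by (auto simp: card_2_iff)
        hence "{a, b} \<in> ?U" using f(1) by (metis imageI insertCI)
        hence "(a, b) \<in> linked ?U" by (rule linked_edge)
        hence "(r (?M a), r (?M b)) \<in> linked ?U" using r linked_sym linked_trans by metis
        moreover have "A = ?M a \<and> B = ?M b \<or> A = ?M b \<and> B = ?M a"
          using f(2) ab by (auto simp: doubleton_eq_iff)
        ultimately show "(r A, r B) \<in> linked ?U" using linked_sym by metis
      qed
      thus ?thesis using r linked_sym linked_trans by metis
    qed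
    show "spans (?M ` verts G) ?S \<longleftrightarrow> spans (verts G) ?U"
      using 1 2 by (auto simp: spans_def)
  qed
  finally show "num_spanning_trees (contract_edge G e) =
      card (cuts s t (verts G) (ends G ` (edges G - {e})))"
    using card_mins_image[OF inj, of "\<lambda>T. spans (verts G) (insert {s, t} T)"] by simp
qed

section \<open>Realizing rational conductances\<close>

text \<open>
  Quantifying over the terminals and over a set \<open>X\<close> of vertices to avoid makes it possible to glue
  networks on a fixed vertex type. The flag \<open>adj\<close> allows an edge between the terminals. The last
  clause says that the network can be drawn into any drawing that contains the edge \<open>{s, t}\<close>.
\<close>

definition realizable :: "bool \<Rightarrow> rat \<Rightarrow> nat \<Rightarrow> bool" where
  "realizable adj x n \<longleftrightarrow> (\<forall>(s :: nat) t X. s \<noteq> t \<longrightarrow> finite X \<longrightarrow>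
     (\<exists>V E. network s t V E \<and> V \<inter> X \<subseteq> {s, t} \<and> ({s, t} \<in> E \<longrightarrow> adj) \<and> card E = n \<and>
        of_nat (card (trees V E)) / of_nat (card (cuts s t V E)) = x \<and>
        (\<forall>p W F. straight p W F \<longrightarrow> {s, t} \<in> F \<longrightarrow> V \<inter> W \<subseteq> {s, t} \<longrightarrow>
           (\<exists>p'. straight p' (W \<union> V) (F \<union> E)))))"

lemma realizableE:
  fixes s t :: nat
  assumes "realizable adj x n" "s \<noteq> t" "finite X"
  obtains V E where "network s t V E" "V \<inter> X \<subseteq> {s, t}" "{s, t} \<in> E \<longrightarrow> adj" "card E = n"
    "of_nat (card (trees V E)) / of_nat (card (cuts s t V E)) = x"
    "\<And>p W F. straight p W F \<Longrightarrow> {s, t} \<in> F \<Longrightarrow> V \<inter> W \<subseteq> {s, t} \<Longrightarrow> \<exists>p'. straight p' (W \<union> V) (F \<union> E)"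
proof -
  from assms(1)[unfolded realizable_def, rule_format, OF assms(2,3)]
  show thesis by (elim exE conjE) (rule that; (assumption | blast))
qed

text \<open>One tree and one cut, the empty set. Every drawing to be extended contains this edge
  already.\<close>

lemma realizable_edge: "realizable True 1 1"
  unfolding realizable_def
proof (intro allI impI)
  fix s t :: nat and X :: "nat set"
  assume st: "s \<noteq> t"
  have "straight p (W \<union> {s, t}) (F \<union> {{s, t}})" if "straight p W F" "{s, t} \<in> F" for p W F
  proof -
    have "s \<in> W" "t \<in> W" using that by (auto simp: straight_def)
    hence "W \<union> {s, t} = W" "F \<union> {{s, t}} = F" using that(2) by auto
    thus ?thesis using that(1) by simp
  qed
  thus "\<exists>V E. network s t V E \<and> V \<inter> X \<subseteq> {s, t} \<and> ({s, t} \<in> E \<longrightarrow> True) \<and> card E = 1 \<and>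
      of_nat (card (trees V E)) / of_nat (card (cuts s t V E)) = (1 :: rat) \<and>
      (\<forall>p W F. straight p W F \<longrightarrow> {s, t} \<in> F \<longrightarrow> V \<inter> W \<subseteq> {s, t} \<longrightarrow>
           (\<exists>p'. straight p' (W \<union> V) (F \<union> E)))"
    using st by (intro exI[of _ "{s, t}"] exI[of _ "{{s, t}}"] conjI)
      (auto simp: network_def single_edge)
qed

text \<open>The flag \<open>False\<close> on both sides keeps the edge sets disjoint: the parts
  share only the terminals, so a common edge would have to be \<open>{s, t}\<close>.\<close>

lemma realizable_parallel:
  assumes "realizable False x n" "realizable False y m" "x > 0" "y > 0"
  shows "realizable False (x + y) (n + m)"
  unfolding realizable_def
proof (intro allI impI)
  fix s t :: nat and X :: "nat set"
  assume st: "s \<noteq> t" and X: "finite X"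
  obtain V1 E1 where 1: "network s t V1 E1" "V1 \<inter> X \<subseteq> {s, t}" "{s, t} \<notin> E1" "card E1 = n"
    "of_nat (card (trees V1 E1)) / of_nat (card (cuts s t V1 E1)) = x"
    "\<And>p W F. straight p W F \<Longrightarrow> {s, t} \<in> F \<Longrightarrow> V1 \<inter> W \<subseteq> {s, t} \<Longrightarrow> \<exists>p'. straight p' (W \<union> V1) (F \<union> E1)"
    using realizableE[OF assms(1) st X] by metis
  have "finite (X \<union> V1)" using X 1(1) by (simp add: network_def)
  then obtain V2 E2 where 2: "network s t V2 E2" "V2 \<inter> (X \<union> V1) \<subseteq> {s, t}" "{s, t} \<notin> E2" "card E2 = m"
    "of_nat (card (trees V2 E2)) / of_nat (card (cuts s t V2 E2)) = y"
    "\<And>p W F. straight p W F \<Longrightarrow> {s, t} \<in> F \<Longrightarrow> V2 \<inter> W \<subseteq> {s, t} \<Longrightarrow> \<exists>p'. straight p' (W \<union> V2) (F \<union> E2)"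
    using realizableE[OF assms(2) st] by metis
  have V: "V1 \<inter> V2 = {s, t}" using 1(1) 2(1,2) by (auto simp: network_def)
  have E: "E1 \<inter> E2 = {}"
  proof (rule ccontr)
    assume "E1 \<inter> E2 \<noteq> {}"
    then obtain e where e: "e \<in> E1" "e \<in> E2" by blast
    then obtain a b where ab: "e = {a, b}" using 1(1) by (auto simp: network_def)
    have "a \<in> {s, t}" "b \<in> {s, t}" "a \<noteq> b"
      using network_edge[OF 1(1) _ order_refl, of a b] network_edge[OF 2(1) _ order_refl, of a b] e ab V by auto
    hence "e = {s, t}" using ab by auto
    thus False using e(1) 1(3) by simp
  qed
  define a b c d where "a = (of_nat (card (trees V1 E1)) :: rat)" and "b = (of_nat (card (cuts s t V1 E1)) :: rat)"
    and "c = (of_nat (card (trees V2 E2)) :: rat)" and "d = (of_nat (card (cuts s t V2 E2)) :: rat)"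
  have "a / b = x" "c / d = y" using 1(5) 2(5) by (simp_all add: a_def b_def c_def d_def)
  \<comment> \<open>Division by zero gives 0, so positive quotients force nonzero cut
    counts.\<close>
  moreover from this have "b \<noteq> 0" "d \<noteq> 0" using assms(3,4) by auto
  ultimately have "(a * d + b * c) / (b * d) = x + y" by (auto simp: field_simps)
  hence "of_nat (card (trees (V1 \<union> V2) (E1 \<union> E2))) / of_nat (card (cuts s t (V1 \<union> V2) (E1 \<union> E2))) = x + y"
    using card_parallel[OF 1(1) 2(1) V E] by (simp add: a_def b_def c_def d_def)
  moreover have "\<exists>p'. straight p' (W \<union> (V1 \<union> V2)) (F \<union> (E1 \<union> E2))"
    if p: "straight p W F" "{s, t} \<in> F" "(V1 \<union> V2) \<inter> W \<subseteq> {s, t}" for p W F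
  proof -
    obtain p1 where p1: "straight p1 (W \<union> V1) (F \<union> E1)" using 1(6)[OF p(1,2)] p(3) by auto
    have "V2 \<inter> (W \<union> V1) \<subseteq> {s, t}" using p(3) V by auto
    then obtain p2 where "straight p2 (W \<union> V1 \<union> V2) (F \<union> E1 \<union> E2)" using 2(6)[OF p1] p(2) by auto
    thus ?thesis by (auto simp: Un_assoc)
  qed
  moreover have "card (E1 \<union> E2) = n + m"
    using 1(4) 2(4) E network_finite[OF 1(1)] network_finite[OF 2(1)] by (simp add: card_Un_disjoint)
  ultimately show "\<exists>V E. network s t V E \<and> V \<inter> X \<subseteq> {s, t} \<and> ({s, t} \<in> E \<longrightarrow> False) \<and> card E = n + m \<and>
      of_nat (card (trees V E)) / of_nat (card (cuts s t V E)) = x + y \<and>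
      (\<forall>p W F. straight p W F \<longrightarrow> {s, t} \<in> F \<longrightarrow> V \<inter> W \<subseteq> {s, t} \<longrightarrow>
           (\<exists>p'. straight p' (W \<union> V) (F \<union> E)))"
    using network_parallel[OF 1(1) 2(1)] 1(2,3) 2(2,3)
    by (intro exI[of _ "V1 \<union> V2"] exI[of _ "E1 \<union> E2"] conjI allI impI) auto
qed

text \<open>The parts meet in a fresh vertex \<open>r\<close> alone, so they share no edge and may
  have adjacent terminals themselves, while \<open>s\<close> and \<open>t\<close> become
  nonadjacent.\<close>

lemma realizable_series:
  assumes "realizable adj x n" "realizable adj' y m" "x > 0" "y > 0"
  shows "realizable False (x * y / (x + y)) (n + m)"
  unfolding realizable_def
proof (intro allI impI)
  fix s t :: nat and X :: "nat set"
  assume st: "s \<noteq> t" and X: "finite X"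
  obtain r where r: "r \<notin> X \<union> {s, t}" using ex_new_if_finite[of "X \<union> {s, t}"] X by auto
  hence sr: "s \<noteq> r" and rt: "r \<noteq> t" by auto
  \<comment> \<open>Putting \<open>s\<close> and \<open>t\<close> among the vertices to avoid keeps
    \<open>t\<close> out of the first part.\<close>
  have "finite (X \<union> {s, t})" using X by simp
  then obtain V1 E1 where 1: "network s r V1 E1" "V1 \<inter> (X \<union> {s, t}) \<subseteq> {s, r}" "card E1 = n"
    "of_nat (card (trees V1 E1)) / of_nat (card (cuts s r V1 E1)) = x"
    "\<And>p W F. straight p W F \<Longrightarrow> {s, r} \<in> F \<Longrightarrow> V1 \<inter> W \<subseteq> {s, r} \<Longrightarrow> \<exists>p'. straight p' (W \<union> V1) (F \<union> E1)"
    using realizableE[OF assms(1) sr] by metis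
  have "finite (X \<union> {s, t} \<union> V1)" using X 1(1) by (simp add: network_def)
  then obtain V2 E2 where 2: "network r t V2 E2" "V2 \<inter> (X \<union> {s, t} \<union> V1) \<subseteq> {r, t}" "card E2 = m"
    "of_nat (card (trees V2 E2)) / of_nat (card (cuts r t V2 E2)) = y"
    "\<And>p W F. straight p W F \<Longrightarrow> {r, t} \<in> F \<Longrightarrow> V2 \<inter> W \<subseteq> {r, t} \<Longrightarrow> \<exists>p'. straight p' (W \<union> V2) (F \<union> E2)"
    using realizableE[OF assms(2) rt] by metis
  have V1: "s \<in> V1" "r \<in> V1" "t \<notin> V1" using 1(1,2) st rt by (auto simp: network_def)
  have V2: "t \<in> V2" "r \<in> V2" "s \<notin> V2" using 2(1,2) st sr by (auto simp: network_def)
  have V: "V1 \<inter> V2 = {r}" using V1 V2 2(2) by auto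
  have E1: "e \<subseteq> V1" "card e = 2" if "e \<in> E1" for e using 1(1) that by (auto simp: network_def)
  have E2: "e \<subseteq> V2" "card e = 2" if "e \<in> E2" for e using 2(1) that by (auto simp: network_def)
  have E: "E1 \<inter> E2 = {}"
  proof (rule ccontr)
    assume "E1 \<inter> E2 \<noteq> {}"
    then obtain e where e: "e \<in> E1" "e \<in> E2" by blast
    hence "e \<subseteq> {r}" using E1 E2 V by blast
    hence "card e \<le> 1" using card_mono[of "{r}" e] by simp
    thus False using E1(2)[OF e(1)] by simp
  qed
  have nadj: "{s, t} \<notin> E1 \<union> E2" using E1(1) E2(1) V1 V2 by blast
  define a b c d where "a = (of_nat (card (trees V1 E1)) :: rat)" and "b = (of_nat (card (cuts s r V1 E1)) :: rat)"
    and "c = (of_nat (card (trees V2 E2)) :: rat)" and "d = (of_nat (card (cuts r t V2 E2)) :: rat)"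
  have xy: "a / b = x" "c / d = y" using 1(4) 2(4) by (simp_all add: a_def b_def c_def d_def)
  hence bd: "b \<noteq> 0" "d \<noteq> 0" using assms(3,4) by auto
  hence ac: "a = x * b" "c = y * d" using xy by (auto simp: field_simps)
  have "a * d + b * c = (x + y) * (b * d)" "a * c = x * y * (b * d)" unfolding ac by (simp_all add: algebra_simps)
  hence "(a * c) / (a * d + b * c) = x * y / (x + y)" using bd by simp
  hence "of_nat (card (trees (V1 \<union> V2) (E1 \<union> E2))) / of_nat (card (cuts s t (V1 \<union> V2) (E1 \<union> E2)))
      = x * y / (x + y)"
    using card_series[OF 1(1) 2(1) V E] by (simp add: a_def b_def c_def d_def)
  moreover have "\<exists>p'. straight p' (W \<union> (V1 \<union> V2)) (F \<union> (E1 \<union> E2))"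
    if p: "straight p W F" "{s, t} \<in> F" "(V1 \<union> V2) \<inter> W \<subseteq> {s, t}" for p W F
  proof -
    have "r \<notin> W" using p(3) V1 sr rt by auto
    \<comment> \<open>The ear on \<open>{s, t}\<close> supplies the edges \<open>{s, r}\<close> and
      \<open>{r, t}\<close>, along which the two parts can be drawn.\<close>
    then obtain p0 where p0: "straight p0 (insert r W) (insert {s, r} (insert {r, t} F))"
      using straight_ear[OF p(1,2)] by blast
    have "V1 \<inter> insert r W \<subseteq> {s, r}" using p(3) V1 by auto
    then obtain p1 where p1: "straight p1 (insert r W \<union> V1) (insert {s, r} (insert {r, t} F) \<union> E1)"
      using 1(5)[OF p0] by auto
    have "V2 \<inter> (insert r W \<union> V1) \<subseteq> {r, t}" using p(3) V V2 by auto
    then obtain p2 where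
      p2: "straight p2 (insert r W \<union> V1 \<union> V2) (insert {s, r} (insert {r, t} F) \<union> E1 \<union> E2)"
      using 2(5)[OF p1] by auto
    have "insert r W \<union> V1 \<union> V2 = W \<union> (V1 \<union> V2)" using V1 by auto
    with p2 have "straight p2 (W \<union> (V1 \<union> V2)) (insert {s, r} (insert {r, t} F) \<union> E1 \<union> E2)" by simp
    \<comment> \<open>The two helper edges are dropped again, unless they belong to \<open>F\<close>
      or to one of the parts.\<close>
    hence "straight p2 (W \<union> (V1 \<union> V2)) (F \<union> (E1 \<union> E2))" by (rule straight_subset) auto
    thus ?thesis by blast
  qed
  moreover have "card (E1 \<union> E2) = n + m"
    using 1(3) 2(3) E network_finite[OF 1(1)] network_finite[OF 2(1)] by (simp add: card_Un_disjoint)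
  moreover have "(V1 \<union> V2) \<inter> X \<subseteq> {s, t}" using 1(2) 2(2) r by auto
  ultimately show "\<exists>V E. network s t V E \<and> V \<inter> X \<subseteq> {s, t} \<and> ({s, t} \<in> E \<longrightarrow> False) \<and> card E = n + m \<and>
      of_nat (card (trees V E)) / of_nat (card (cuts s t V E)) = x * y / (x + y) \<and>
      (\<forall>p W F. straight p W F \<longrightarrow> {s, t} \<in> F \<longrightarrow> V \<inter> W \<subseteq> {s, t} \<longrightarrow>
           (\<exists>p'. straight p' (W \<union> V) (F \<union> E)))"
    using network_series[OF 1(1) 2(1) V] nadj
    by (intro exI[of _ "V1 \<union> V2"] exI[of _ "E1 \<union> E2"] conjI allI impI) auto
qed

section \<open>Conductances from continued fractions\<close>

lemma realizable_unit: "realizable False 1 4"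
proof -
  \<comment> \<open>A path of two edges has nonadjacent terminals, so two copies can be put in
    parallel.\<close>
  have "realizable False (1 / 2) 2"
    using realizable_series[OF realizable_edge realizable_edge] by (simp add: numeral_2_eq_2)
  from realizable_parallel[OF this this] show ?thesis by simp
qed

lemma realizable_add_units:
  assumes "realizable False x n" "x > 0"
  shows "realizable False (x + of_nat a) (n + 4 * a)"
proof (induction a)
  case (Suc a)
  from realizable_parallel[OF this realizable_unit] assms(2) show ?case
    by (simp add: add_pos_nonneg algebra_simps)
qed (use assms in simp)

text \<open>A unit in series raises the resistance \<open>x\<close> by 1.\<close>

lemma realizable_inverse_add_units:
  assumes "realizable False (1 / x) n" "x > 0"
  shows "realizable False (1 / (x + of_nat a)) (n + 4 * a)"
proof (induction a)
  case (Suc a)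
  have pos: "x + of_nat a > 0" using assms(2) by (simp add: add_pos_nonneg)
  have "1 / (x + of_nat a) * 1 / (1 / (x + of_nat a) + 1) = 1 / (x + of_nat (Suc a))"
    using pos by (simp add: field_simps)
  with realizable_series[OF Suc realizable_unit] pos show ?case
    by (simp add: algebra_simps)
qed (use assms in simp)

text \<open>A value and its reciprocal are realized together: with \<open>c\<close> the value of the
  tail, \<open>a + 1 / c\<close> is built from \<open>1 / c\<close> by parallel units, and its
  reciprocal from \<open>c\<close> by units in series.\<close>

lemma realizable_cfrac_pos:
  assumes "as \<noteq> []" "\<forall>a\<in>set as. a \<ge> 1"
  shows "realizable False (cfrac as) (4 * sum_list as) \<and> realizable False (1 / cfrac as) (4 * sum_list as)"
  using assms
proof (induction as)
  case (Cons a as)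
  show ?case
  proof (cases "as = []")
    case True
    \<comment> \<open>The initial network is one unit itself, so \<open>a - 1\<close> further units
      are added.\<close>
    have "a = Suc (a - 1)" using Cons.prems by simp
    then obtain b where "a = Suc b" by blast
    thus ?thesis
      using realizable_add_units[OF realizable_unit, of b] realizable_inverse_add_units[of 1 4 b]
        realizable_unit True by (simp add: algebra_simps)
  next
    case False
    define c where "c = cfrac as"
    have "c \<ge> 1" using cfrac_ge_1(1)[OF False] Cons.prems by (simp add: c_def)
    hence c: "c > 0" by simp
    have IH: "realizable False c (4 * sum_list as)" "realizable False (1 / c) (4 * sum_list as)"
      using Cons False by (auto simp: c_def)
    have "realizable False (1 / c + of_nat a) (4 * sum_list as + 4 * a)"
      by (rule realizable_add_units) (use IH c in auto)
    moreover have "realizable False (1 / (1 / c + of_nat a)) (4 * sum_list as + 4 * a)"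
      by (rule realizable_inverse_add_units) (use IH c in auto)
    ultimately show ?thesis using False by (simp add: cfrac_Cons c_def algebra_simps)
  qed
qed simp

text \<open>The leading partial quotient may be 0, which \<open>realizable_cfrac_pos\<close>
  excludes. So that lemma is applied to the tail, and the leading term adds a possibly empty set of
  parallel units.\<close>

lemma realizable_rat:
  assumes "q > 0"
  shows "realizable False q (4 * quot_sum q)"
proof -
  obtain as where as: "admissible as" "cfrac as = q" using ex_cfrac[of q] assms by auto
  have qs: "quot_sum q = sum_list as" using quot_sum_eq as by metis
  obtain a bs where ab: "as = a # bs" using as(1) by (cases as) (auto simp: admissible_def)
  have bs: "\<forall>b\<in>set bs. b \<ge> 1" using as(1) ab by (simp add: admissible_def)
  show ?thesis
  proof (cases "bs = []")
    case True
    hence "a \<ge> 1" using ab as(2) assms by (cases a) auto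
    thus ?thesis using realizable_cfrac_pos[of as] ab True as(2) qs by simp
  next
    case False
    define c where "c = cfrac bs"
    have "c \<ge> 1" using cfrac_ge_1(1)[OF False bs] by (simp add: c_def)
    hence c: "1 / c > 0" by simp
    have "realizable False (1 / c) (4 * sum_list bs)"
      using realizable_cfrac_pos[OF False bs] by (simp add: c_def)
    from realizable_add_units[OF this c, of a]
    show ?thesis using qs as(2) ab False by (simp add: cfrac_Cons c_def algebra_simps)
  qed
qed

text \<open>The induction starts at 1 so that every partial sum is positive, as
  \<open>realizable_parallel\<close> demands.\<close>

lemma realizable_sum:
  fixes q :: "nat \<Rightarrow> rat" and k :: nat
  assumes "k \<ge> 1" "\<And>i. i \<in> {1..k} \<Longrightarrow> q i > 0"
  shows "realizable False (\<Sum>i = 1..k. q i) (4 * (\<Sum>i = 1..k. quot_sum (q i)))"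
  using assms
proof (induction k rule: nat_induct_at_least)
  case base
  thus ?case using realizable_rat[of "q 1"] by simp
next
  case (Suc k)
  have "(\<Sum>i = 1..k. q i) > 0" using Suc.prems Suc.hyps by (intro sum_pos) auto
  with realizable_parallel[OF Suc.IH realizable_rat[of "q (Suc k)"]] Suc.prems
  show ?case by (simp add: distrib_left)
qed

theorem theorem1p5:
  fixes q :: "nat \<Rightarrow> rat" and k :: nat
  assumes "k \<ge> 1"
    and "\<And>i. i \<in> {1..k} \<Longrightarrow> q i > 0"
  shows "\<exists>(G :: (nat, nat) mgraph) e.
           simple_mgraph G \<and> planar G \<and> e \<in> edges G \<and>
           of_nat (num_spanning_trees (delete_edge G e))
             / of_nat (num_spanning_trees (contract_edge G e)) = (\<Sum>i = 1..k. q i) \<and>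
           card (edges G) = 4 * (\<Sum>i = 1..k. quot_sum (q i)) + 1"
proof -
  have R: "realizable False (\<Sum>i = 1..k. q i) (4 * (\<Sum>i = 1..k. quot_sum (q i)))"
    using assms by (rule realizable_sum)
  obtain V E where N: "network (0 :: nat) 1 V E" "{0, 1} \<notin> E" "card E = 4 * (\<Sum>i = 1..k. quot_sum (q i))"
    "of_nat (card (trees V E)) / of_nat (card (cuts 0 1 V E)) = (\<Sum>i = 1..k. q i)"
    and ext: "\<And>p W F. straight p W F \<Longrightarrow> {0, 1} \<in> F \<Longrightarrow> V \<inter> W \<subseteq> {0, 1} \<Longrightarrow>
      \<exists>p'. straight p' (W \<union> V) (F \<union> E)"
    by (rule realizableE[OF R zero_neq_one finite.emptyI])
      (rule that; (assumption | blast))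
  have V: "0 \<in> V" "1 \<in> V" "finite V" using N(1) by (auto simp: network_def)
  have finE: "finite E" using N(1) by (rule network_finite)
  define F where "F = insert {0, 1} E"
  have F: "f \<subseteq> V \<and> card f = 2" if "f \<in> F" for f
    using that N(1) by (auto simp: F_def network_def)
  \<comment> \<open>The edges of \<open>G\<close> are natural numbers, so the pairs in
    \<open>F\<close> are numbered by \<open>h\<close>.\<close>
  obtain h where h: "bij_betw h {0..<card F} F"
    using ex_bij_betw_nat_finite[of F] finE by (auto simp: F_def)
  define G :: "(nat, nat) mgraph" where "G = \<lparr>verts = V, edges = {0..<card F}, ends = h\<rparr>"
  have G: "verts G = V" "edges G = {0..<card F}" "ends G = h" by (simp_all add: G_def)
  have h': "h ` edges G = F" "inj_on h (edges G)" using h by (auto simp: G bij_betw_def)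
  have "{0, 1} \<in> h ` edges G" unfolding h'(1) F_def by blast
  then obtain e where e: "e \<in> edges G" "h e = {0, 1}" by (metis imageE)
  have he: "h ` (edges G - {e}) = E"
    using h' e N(2) inj_on_image_set_diff[OF h'(2), of "edges G" "{e}"] by (auto simp: F_def)
  have simple: "simple_mgraph G"
    using F h' V G by (auto simp: simple_mgraph_def loopless_mgraph_def)
  \<comment> \<open>The drawing starts from the edge \<open>{0, 1}\<close> alone, into which the
    network is inserted; that edge becomes \<open>e\<close>.\<close>
  obtain p where "straight p {0 :: nat, 1} {{0, 1}}" using straight_edge[of "0 :: nat" 1] by auto
  from ext[OF this] obtain p' where "straight p' ({0, 1} \<union> V) ({{0, 1}} \<union> E)" by auto
  moreover have "{0, 1} \<union> V = V" "{{0, 1}} \<union> E = F" using V by (auto simp: F_def)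
  ultimately have "straight p' V F" by metis
  moreover have "card (ends G f) = 2" if "f \<in> edges G" for f
    using F[of "h f"] h'(1) that G(3) by blast
  ultimately have "planar G" using planar_straight[of p' G] h' unfolding G by metis
  moreover have "of_nat (num_spanning_trees (delete_edge G e))
      / of_nat (num_spanning_trees (contract_edge G e)) = (\<Sum>i = 1..k. q i)"
    using simple_mgraph_counts[OF simple e(1), of 0 1] e(2) he N(4) by (simp add: G)
  moreover have "card (edges G) = 4 * (\<Sum>i = 1..k. quot_sum (q i)) + 1"
    using N(2,3) finE by (simp add: G F_def)
  ultimately show ?thesis using simple e(1) by blast
qed

end
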